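(* The processes $\left(Y^{(N)}_t\right)_{t\in[0,T]}$, where $Y^{(N)}_t=Y^{(N)}_{\lfloor tN/T\rfloor}$, converge weakly in the Skorokhod topology (i.e. as random elements of $D([0,T])$) to $(Y_t)_{t\in[0,T]}$ as $N\to\infty$.
   Context: Fix $T>0$. $\mathbb N=\{1,2,\dots\}$. On a probability space $(\Omega,\mathcal F,\mathbb P)$ let $(Y_t)_{t\ge0}$ be a uniformly ergodic Markov jump process with values in $\mathbb N$, with $Y_0=1$ and infinitesimal matrix having diagonal entries $-\lambda_i$ and off-diagonal entries $\lambda_{ij}>0$ ($i\ne j$), where $\sum_{j\neq i}\lambda_{ij}=\lambda_i$ for all $i$, $\lambda_*=\inf_i\lambda_i>0$ and $\lambda^*=\sup_i\lambda_i<\infty$. Its transition probabilities are denoted $p_{ij}(t)=\mathbb P(Y_t=j\mid Y_0=i)$. For each $N\in\mathbb N$, on a probability space $(\Omega^{(N)},\mathcal F^{(N)},\mathbb P^{(N)})$, let $(Y^{(N)}_k)_{k\ge0}$ be a time-homogeneous Markov chain in $\mathbb N$ with $Y^{(N)}_0=1$ whose one-step transition matrix has diagonal entries $$\mathbb P^{(N)}(Y^{(N)}_{k+1}=i\mid Y^{(N)}_k=i)=\mathbb P(Y_s=i,\ 0\le s\le T/N\mid Y_0=i)=e^{-\lambda_iT/N}$$ and off-diagonal entries $$p^{(N)}_{ij}=\mathbb P^{(N)}(Y^{(N)}_{k+1}=j\mid Y^{(N)}_k=i)=p_{ij}(T/N),\qquad i\ne j.$$ The continuous-time version is defined by $Y^{(N)}_t=Y^{(N)}_{\lfloor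 tN/T\rfloor}$, $t\in[0,T]$.
   Formalization: The printed one-step matrix has row sums below 1, since p_ii(T/N) > e^{-λ_i T/N}, so no such chain on ℕ exists; the formal statement keeps all printed entries and sends the missing mass to an added absorbing state 0 outside ℕ={1,2,…}. *)

theory Defs
  imports "HOL-Probability.Probability"
begin

section \<open>The Skorokhod space\<close>

text \<open>
  At an endpoint of \<open>S\<close> the missing one-sided condition is void, because the filter is then trivial.
\<close>

definition cadlag_on :: "real set \<Rightarrow> (real \<Rightarrow> real) \<Rightarrow> bool" where
  "cadlag_on S x \<longleftrightarrow>
     (\<forall>t\<in>S. (x \<longlongrightarrow> x t) (at t within S \<inter> {t<..})) \<and>
     (\<forall>t\<in>S. \<exists>l. (x \<longlongrightarrow> l) (at t within S \<inter> {..<t}))"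

definition cadlag_space :: "real \<Rightarrow> (real \<Rightarrow> real) set" where
  "cadlag_space T = {x \<in> extensional {0..T}. cadlag_on {0..T} x}"

definition time_changes :: "real \<Rightarrow> (real \<Rightarrow> real) set" where
  "time_changes T =
     {\<mu>. strict_mono_on {0..T} \<mu> \<and> continuous_on {0..T} \<mu> \<and> \<mu> ` {0..T} = {0..T}}"

definition skorokhod_close :: "real \<Rightarrow> (real \<Rightarrow> real) \<Rightarrow> (real \<Rightarrow> real) \<Rightarrow> real \<Rightarrow> bool" where
  "skorokhod_close T x y e \<longleftrightarrow>
     (\<exists>\<mu>\<in>time_changes T. \<forall>t\<in>{0..T}. \<bar>\<mu> t - t\<bar> \<le> e \<and> \<bar>x t - y (\<mu> t)\<bar> \<le> e)"

text \<open>
  The value \<open>0\<close> off the carrier only serves to meet the side conditions of \<^locale>\<open>Metric_space\<close>.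
\<close>

definition skorokhod_dist :: "real \<Rightarrow> (real \<Rightarrow> real) \<Rightarrow> (real \<Rightarrow> real) \<Rightarrow> real" where
  "skorokhod_dist T x y =
     (if x \<in> cadlag_space T \<and> y \<in> cadlag_space T
      then Inf {e. 0 < e \<and> skorokhod_close T x y e} else 0)"

definition skorokhod_topology :: "real \<Rightarrow> (real \<Rightarrow> real) topology" where
  "skorokhod_topology T = Metric_space.mtopology (cadlag_space T) (skorokhod_dist T)"

lemma time_changes_id: "(\<lambda>t. t) \<in> time_changes T"
  by (auto simp: time_changes_def strict_mono_on_def)

lemma time_changes_inverse:
  assumes "\<mu> \<in> time_changes T"
  shows "inv_into {0..T} \<mu> \<in> time_changes T"
proof -
  have sm: "strict_mono_on {0..T} \<mu>" and co: "continuous_on {0..T} \<mu>"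
    and im: "\<mu> ` {0..T} = {0..T}"
    using assms by (auto simp: time_changes_def)
  have inj: "inj_on \<mu> {0..T}"
    using sm by (rule strict_mono_on_imp_inj_on)
  let ?\<nu> = "inv_into {0..T} \<mu>"
  have l: "?\<nu> (\<mu> t) = t" if "t \<in> {0..T}" for t
    using inj that by simp
  have r: "\<mu> (?\<nu> s) = s" "?\<nu> s \<in> {0..T}" if "s \<in> {0..T}" for s
    using that im by (metis f_inv_into_f, metis inv_into_into)
  have "strict_mono_on {0..T} ?\<nu>"
  proof (rule strict_mono_onI)
    fix a b assume ab: "a \<in> {0..T}" "b \<in> {0..T}" "a < b"
    show "?\<nu> a < ?\<nu> b"
    proof (rule ccontr)
      assume "\<not> ?\<nu> a < ?\<nu> b"
      then have "\<mu> (?\<nu> b) \<le> \<mu> (?\<nu> a)"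
        using strict_mono_on_leD[OF sm r(2)[OF ab(2)] r(2)[OF ab(1)]] by simp
      then show False using r(1) ab by simp
    qed
  qed
  moreover have "continuous_on {0..T} ?\<nu>"
    using continuous_on_inv[OF co _ , of ?\<nu>] l im by simp
  moreover have "?\<nu> ` {0..T} = {0..T}"
    using inv_into_image_cancel[OF inj, of "{0..T}"] im by simp
  ultimately show ?thesis by (simp add: time_changes_def)
qed

lemma time_changes_comp:
  assumes "\<mu> \<in> time_changes T" "\<nu> \<in> time_changes T"
  shows "(\<lambda>t. \<nu> (\<mu> t)) \<in> time_changes T"
proof -
  have m: "\<mu> t \<in> {0..T}" if "t \<in> {0..T}" for t
    using assms(1) that by (auto simp: time_changes_def)
  have "strict_mono_on {0..T} (\<lambda>t. \<nu> (\<mu> t))"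
    using assms m unfolding time_changes_def strict_mono_on_def by blast
  moreover have "continuous_on {0..T} (\<lambda>t. \<nu> (\<mu> t))"
    using assms by (auto simp: time_changes_def intro!: continuous_on_compose2[of _ \<nu> _ \<mu>])
  moreover have "(\<lambda>t. \<nu> (\<mu> t)) ` {0..T} = {0..T}"
    using assms by (auto simp: time_changes_def simp flip: image_image)
  ultimately show ?thesis by (simp add: time_changes_def)
qed

lemma skorokhod_close_sym:
  assumes "skorokhod_close T x y e"
  shows "skorokhod_close T y x e"
proof -
  obtain \<mu> where \<mu>: "\<mu> \<in> time_changes T"
    and c: "\<And>t. t \<in> {0..T} \<Longrightarrow> \<bar>\<mu> t - t\<bar> \<le> e \<and> \<bar>x t - y (\<mu> t)\<bar> \<le> e"
    using assms by (auto simp: skorokhod_close_def)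
  have im: "\<mu> ` {0..T} = {0..T}" using \<mu> by (simp add: time_changes_def)
  let ?\<nu> = "inv_into {0..T} \<mu>"
  have "\<bar>?\<nu> s - s\<bar> \<le> e \<and> \<bar>y s - x (?\<nu> s)\<bar> \<le> e" if "s \<in> {0..T}" for s
  proof -
    have "\<mu> (?\<nu> s) = s" "?\<nu> s \<in> {0..T}"
      using that im by (metis f_inv_into_f, metis inv_into_into)
    then show ?thesis using c[of "?\<nu> s"] by (simp add: abs_minus_commute)
  qed
  then show ?thesis
    unfolding skorokhod_close_def by (intro bexI[OF _ time_changes_inverse[OF \<mu>]]) blast
qed

lemma skorokhod_close_trans:
  assumes "skorokhod_close T x y a" "skorokhod_close T y z b"
  shows "skorokhod_close T x z (a + b)"
proof -
  obtain \<mu> where \<mu>: "\<mu> \<in> time_changes T"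
    and c: "\<And>t. t \<in> {0..T} \<Longrightarrow> \<bar>\<mu> t - t\<bar> \<le> a \<and> \<bar>x t - y (\<mu> t)\<bar> \<le> a"
    using assms(1) by (auto simp: skorokhod_close_def)
  obtain \<nu> where \<nu>: "\<nu> \<in> time_changes T"
    and d: "\<And>t. t \<in> {0..T} \<Longrightarrow> \<bar>\<nu> t - t\<bar> \<le> b \<and> \<bar>y t - z (\<nu> t)\<bar> \<le> b"
    using assms(2) by (auto simp: skorokhod_close_def)
  have "\<bar>\<nu> (\<mu> t) - t\<bar> \<le> a + b \<and> \<bar>x t - z (\<nu> (\<mu> t))\<bar> \<le> a + b" if "t \<in> {0..T}" for t
  proof -
    have "\<mu> t \<in> {0..T}" using \<mu> that by (auto simp: time_changes_def)
    then show ?thesis using c[OF that] d[of "\<mu> t"] by linarith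
  qed
  then show ?thesis
    unfolding skorokhod_close_def by (intro bexI[OF _ time_changes_comp[OF \<mu> \<nu>]]) blast
qed

lemma cadlag_on_bounded:
  assumes "cadlag_on {0..T} x"
  shows "bounded (x ` {0..T})"
proof -
  have loc: "\<exists>d>0. bounded (x ` ({0..T} \<inter> ball t d))" if t: "t \<in> {0..T}" for t
  proof -
    obtain l where l: "(x \<longlongrightarrow> l) (at t within {0..T} \<inter> {..<t})"
      using assms t unfolding cadlag_on_def by blast
    have r: "(x \<longlongrightarrow> x t) (at t within {0..T} \<inter> {t<..})"
      using assms t by (auto simp: cadlag_on_def)
    obtain d1 where d1: "d1 > 0"
      "\<And>s. s \<in> {0..T} \<inter> {..<t} \<Longrightarrow> dist s t < d1 \<Longrightarrow> dist (x s) l < 1"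
      using tendstoD[OF l zero_less_one] by (auto simp: eventually_at)
    obtain d2 where d2: "d2 > 0"
      "\<And>s. s \<in> {0..T} \<inter> {t<..} \<Longrightarrow> dist s t < d2 \<Longrightarrow> dist (x s) (x t) < 1"
      using tendstoD[OF r zero_less_one] by (auto simp: eventually_at)
    have "x ` ({0..T} \<inter> ball t (min d1 d2)) \<subseteq> ball l 1 \<union> ball (x t) 1"
    proof clarify
      fix s assume s: "s \<in> {0..T}" "s \<in> ball t (min d1 d2)" "x s \<notin> ball (x t) 1"
      then have "s \<noteq> t" by auto
      moreover have "\<not> t < s"
        using s d2(2)[of s] by (auto simp: dist_commute)
      ultimately have "s < t" by linarith
      then show "x s \<in> ball l 1"
        using s d1(2)[of s] by (auto simp: dist_commute)
    qed
    then have "bounded (x ` ({0..T} \<inter> ball t (min d1 d2)))"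
      by (rule bounded_subset[rotated]) simp
    then show ?thesis using d1(1) d2(1) by (intro exI[of _ "min d1 d2"]) simp
  qed
  then obtain d where d: "\<And>t. t \<in> {0..T} \<Longrightarrow> d t > 0 \<and> bounded (x ` ({0..T} \<inter> ball t (d t)))"
    by metis
  obtain C where C: "C \<subseteq> {0..T}" "finite C" "{0..T} \<subseteq> (\<Union>t\<in>C. ball t (d t))"
  proof (rule compactE_image)
    show "compact {0..T}" by simp
    show "open (ball t (d t))" for t by simp
    show "{0..T} \<subseteq> (\<Union>t\<in>{0..T}. ball t (d t))"
    proof
      fix t assume "t \<in> {0..T}"
      then show "t \<in> (\<Union>t\<in>{0..T}. ball t (d t))" using d[of t] by (intro UN_I[of t]) simp_all
    qed
  qed
  have "x ` {0..T} \<subseteq> (\<Union>t\<in>C. x ` ({0..T} \<inter> ball t (d t)))"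
    using C(3) by blast
  moreover have "bounded (\<Union>t\<in>C. x ` ({0..T} \<inter> ball t (d t)))"
    using C d by (intro bounded_UN) auto
  ultimately show ?thesis by (rule bounded_subset[rotated])
qed

lemma skorokhod_close_exists:
  assumes "x \<in> cadlag_space T" "y \<in> cadlag_space T"
  shows "\<exists>e>0. skorokhod_close T x y e"
proof -
  obtain a where a: "\<And>t. t \<in> {0..T} \<Longrightarrow> \<bar>x t\<bar> \<le> a"
    using cadlag_on_bounded[of T x] assms(1)
    unfolding cadlag_space_def bounded_iff by fastforce
  obtain b where b: "\<And>t. t \<in> {0..T} \<Longrightarrow> \<bar>y t\<bar> \<le> b"
    using cadlag_on_bounded[of T y] assms(2)
    unfolding cadlag_space_def bounded_iff by fastforce
  let ?e = "\<bar>a\<bar> + \<bar>b\<bar> + 1"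
  have "\<bar>t - t\<bar> \<le> ?e \<and> \<bar>x t - y t\<bar> \<le> ?e" if "t \<in> {0..T}" for t
    using a[OF that] b[OF that] by linarith
  then have "skorokhod_close T x y ?e"
    unfolding skorokhod_close_def by (intro bexI[OF _ time_changes_id]) blast
  then show ?thesis by (intro exI[of _ ?e]) simp
qed

lemma skorokhod_dist_less:
  assumes "x \<in> cadlag_space T" "y \<in> cadlag_space T" "skorokhod_dist T x y < e"
  shows "\<exists>e'. 0 < e' \<and> e' < e \<and> skorokhod_close T x y e'"
proof -
  have "{e. 0 < e \<and> skorokhod_close T x y e} \<noteq> {}"
    using skorokhod_close_exists[OF assms(1,2)] by blast
  then show ?thesis
    using assms cInf_lessD[of "{e. 0 < e \<and> skorokhod_close T x y e}" e]
    by (auto simp: skorokhod_dist_def)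
qed

lemma skorokhod_dist_le:
  assumes "x \<in> cadlag_space T" "y \<in> cadlag_space T" "0 < e" "skorokhod_close T x y e"
  shows "skorokhod_dist T x y \<le> e"
  using assms unfolding skorokhod_dist_def
  by (auto intro!: cInf_lower bdd_belowI[of _ 0])

lemma skorokhod_dist_nonneg: "0 \<le> skorokhod_dist T x y"
proof (cases "x \<in> cadlag_space T \<and> y \<in> cadlag_space T")
  case True
  then have "{e. 0 < e \<and> skorokhod_close T x y e} \<noteq> {}"
    using skorokhod_close_exists by blast
  then have "0 \<le> Inf {e. 0 < e \<and> skorokhod_close T x y e}"
    by (rule cInf_greatest) simp
  then show ?thesis using True by (simp add: skorokhod_dist_def)
qed (auto simp: skorokhod_dist_def)

lemma skorokhod_dist_eq_0D:
  assumes x: "x \<in> cadlag_space T" and y: "y \<in> cadlag_space T"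
    and 0: "skorokhod_dist T x y = 0"
  shows "x = y"
proof (rule extensionalityI)
  show "x \<in> extensional {0..T}" "y \<in> extensional {0..T}"
    using x y by (auto simp: cadlag_space_def)
  fix t assume t: "t \<in> {0..T}"
  have "\<bar>x t - y t\<bar> \<le> 3 * e" if e: "e > 0" for e
  proof (cases "t = T")
    case True
    obtain e' where e': "e' < e" "skorokhod_close T x y e'"
      using skorokhod_dist_less[OF x y, of e] 0 e by auto
    obtain \<mu> where \<mu>: "\<mu> \<in> time_changes T"
      and c: "\<And>t. t \<in> {0..T} \<Longrightarrow> \<bar>x t - y (\<mu> t)\<bar> \<le> e'"
      using e'(2) by (auto simp: skorokhod_close_def)
    have "T \<in> \<mu> ` {0..T}" using \<mu> t True by (simp add: time_changes_def)
    then obtain s where s: "s \<in> {0..T}" "\<mu> s = T" by auto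
    have "\<mu> T \<in> {0..T}" using \<mu> t True by (auto simp: time_changes_def)
    moreover have "\<mu> s \<le> \<mu> T"
      using \<mu> s t True strict_mono_on_leD[of "{0..T}" \<mu> s T] by (auto simp: time_changes_def)
    ultimately have "\<mu> T = T" using s by auto
    then show ?thesis using c[of T] t True e' e by auto
  next
    case False
    have rx: "(x \<longlongrightarrow> x t) (at t within {0..T} \<inter> {t<..})"
      and ry: "(y \<longlongrightarrow> y t) (at t within {0..T} \<inter> {t<..})"
      using x y t by (auto simp: cadlag_space_def cadlag_on_def)
    obtain d1 where d1: "d1 > 0"
      "\<And>s. s \<in> {0..T} \<inter> {t<..} \<Longrightarrow> dist s t < d1 \<Longrightarrow> dist (x s) (x t) < e"
      using tendstoD[OF rx e] by (auto simp: eventually_at)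
    obtain d2 where d2: "d2 > 0"
      "\<And>s. s \<in> {0..T} \<inter> {t<..} \<Longrightarrow> dist s t < d2 \<Longrightarrow> dist (y s) (y t) < e"
      using tendstoD[OF ry e] by (auto simp: eventually_at)
    define d where "d = min (min d1 d2) (T - t)"
    have d: "d > 0" "d \<le> d1" "d \<le> d2" "t + d \<le> T"
      using d1(1) d2(1) False t by (auto simp: d_def)
    obtain e' where e': "e' < min e (d / 4)" "skorokhod_close T x y e'"
      using skorokhod_dist_less[OF x y, of "min e (d / 4)"] 0 e d(1) by auto
    obtain \<mu> where \<mu>: "\<mu> \<in> time_changes T"
      and c: "\<And>t. t \<in> {0..T} \<Longrightarrow> \<bar>\<mu> t - t\<bar> \<le> e' \<and> \<bar>x t - y (\<mu> t)\<bar> \<le> e'"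
      using e'(2) by (auto simp: skorokhod_close_def)
    let ?s = "t + d / 2"
    have s: "?s \<in> {0..T}" using t d by auto
    have "\<bar>\<mu> ?s - ?s\<bar> < d / 4" "\<bar>x ?s - y (\<mu> ?s)\<bar> < e" using c[OF s] e' by auto
    moreover from this have "t < \<mu> ?s" "\<mu> ?s < t + d" using d by linarith+
    moreover from this have "dist (y (\<mu> ?s)) (y t) < e"
      using d2(2)[of "\<mu> ?s"] d t by (auto simp: dist_real_def)
    moreover have "dist (x ?s) (x t) < e"
      using d1(2)[of ?s] d t s by (auto simp: dist_real_def)
    ultimately show ?thesis by (auto simp: dist_real_def)
  qed
  from this[of "\<bar>x t - y t\<bar> / 6"] show "x t = y t" by (cases "x t = y t") auto
qed

lemma Metric_space_skorokhod: "Metric_space (cadlag_space T) (skorokhod_dist T)"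
proof
  fix x y
  show "0 \<le> skorokhod_dist T x y" by (rule skorokhod_dist_nonneg)
  have "skorokhod_close T x y = skorokhod_close T y x"
    using skorokhod_close_sym by blast
  then show "skorokhod_dist T x y = skorokhod_dist T y x"
    by (auto simp: skorokhod_dist_def)
next
  fix x y assume xy: "x \<in> cadlag_space T" "y \<in> cadlag_space T"
  have "skorokhod_dist T x x \<le> e" if "e > 0" for e
    using that xy by (auto intro!: skorokhod_dist_le bexI[OF _ time_changes_id]
        simp: skorokhod_close_def)
  then have "skorokhod_dist T x x = 0"
    using skorokhod_dist_nonneg[of T x x] by (meson dense_ge order_antisym)
  then show "skorokhod_dist T x y = 0 \<longleftrightarrow> x = y"
    using skorokhod_dist_eq_0D[OF xy] by auto
next
  fix x y z
  assume x: "x \<in> cadlag_space T" and y: "y \<in> cadlag_space T" and z: "z \<in> cadlag_space T"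
  show "skorokhod_dist T x z \<le> skorokhod_dist T x y + skorokhod_dist T y z"
  proof (rule field_le_epsilon)
    fix e :: real assume "e > 0"
    then obtain a b where "0 < a" "a < skorokhod_dist T x y + e / 2" "skorokhod_close T x y a"
      and "0 < b" "b < skorokhod_dist T y z + e / 2" "skorokhod_close T y z b"
      using skorokhod_dist_less[OF x y, of "skorokhod_dist T x y + e / 2"]
        skorokhod_dist_less[OF y z, of "skorokhod_dist T y z + e / 2"] by auto
    then show "skorokhod_dist T x z \<le> skorokhod_dist T x y + skorokhod_dist T y z + e"
      using skorokhod_dist_le[OF x z, of "a + b"] skorokhod_close_trans[of T x y a z b] by simp
  qed
qed

section \<open>Weak convergence on a topological space\<close>

definition borel_measure_of :: "'a topology \<Rightarrow> 'a measure" where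
  "borel_measure_of X = sigma (topspace X) {U. openin X U}"

definition weak_conv_in :: "'a topology \<Rightarrow> (nat \<Rightarrow> 'a measure) \<Rightarrow> 'a measure \<Rightarrow> bool" where
  "weak_conv_in X \<mu> \<nu> \<longleftrightarrow>
     (\<forall>f. continuous_map X euclideanreal f \<and> bounded (f ` topspace X) \<longrightarrow>
        (\<lambda>n. \<integral>x. f x \<partial>\<mu> n) \<longlonglongrightarrow> (\<integral>x. f x \<partial>\<nu>))"

section \<open>Markov processes on the positive integers\<close>

definition transition_function :: "(real \<Rightarrow> nat \<Rightarrow> nat \<Rightarrow> real) \<Rightarrow> bool" where
  "transition_function p \<longleftrightarrow>
     (\<forall>t\<ge>0. \<forall>i\<ge>1. \<forall>j\<ge>1. 0 \<le> p t i j) \<and>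
     (\<forall>t\<ge>0. \<forall>i\<ge>1. (p t i has_sum 1) {1..}) \<and>
     (\<forall>i\<ge>1. \<forall>j\<ge>1. p 0 i j = of_bool (i = j)) \<and>
     (\<forall>s\<ge>0. \<forall>t\<ge>0. \<forall>i\<ge>1. \<forall>j\<ge>1. ((\<lambda>k. p s i k * p t k j) has_sum p (s + t) i j) {1..})"

definition infinitesimal_matrix ::
    "(real \<Rightarrow> nat \<Rightarrow> nat \<Rightarrow> real) \<Rightarrow> (nat \<Rightarrow> nat \<Rightarrow> real) \<Rightarrow> bool" where
  "infinitesimal_matrix p Q \<longleftrightarrow>
     (\<forall>i\<ge>1. \<forall>j\<ge>1. ((\<lambda>t. p t i j) has_real_derivative Q i j) (at 0 within {0..}))"

text \<open>
  Convergence to the stationary distribution in total variation (up to the usual factor),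
  uniformly in the initial state.
\<close>

definition uniformly_ergodic :: "(real \<Rightarrow> nat \<Rightarrow> nat \<Rightarrow> real) \<Rightarrow> bool" where
  "uniformly_ergodic p \<longleftrightarrow>
     (\<exists>\<pi>. (\<forall>j\<ge>1. 0 \<le> \<pi> j) \<and> (\<pi> has_sum 1) {1..} \<and>
          (\<forall>t\<ge>0. \<forall>j\<ge>1. ((\<lambda>i. \<pi> i * p t i j) has_sum \<pi> j) {1..}) \<and>
          ((\<lambda>t. SUP i\<in>{1..}. \<Sum>\<^sub>\<infinity>j\<in>{1..}. \<bar>p t i j - \<pi> j\<bar>) \<longlongrightarrow> 0) at_top)"

text \<open>
  For integer-valued paths, being cadlag as a real function means being a right-continuous step
  function with finitely many jumps in bounded time.
\<close>

definition markov_jump_process ::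
    "'a measure \<Rightarrow> (real \<Rightarrow> nat \<Rightarrow> nat \<Rightarrow> real) \<Rightarrow> (real \<Rightarrow> 'a \<Rightarrow> nat) \<Rightarrow> bool" where
  "markov_jump_process M p Y \<longleftrightarrow>
     prob_space M \<and> transition_function p \<and>
     (\<forall>t\<ge>0. Y t \<in> M \<rightarrow>\<^sub>M count_space {1..}) \<and>
     (\<forall>\<omega>\<in>space M. cadlag_on {0..} (\<lambda>t. real (Y t \<omega>))) \<and>
     (\<forall>n (t :: nat \<Rightarrow> real) (i :: nat \<Rightarrow> nat) (s :: real) (j :: nat).
        0 \<le> t 0 \<and> (\<forall>k<n. t k < t (Suc k)) \<and> t n < s \<and> 1 \<le> j \<and>
        \<P>(\<omega> in M. \<forall>k\<le>n. Y (t k) \<omega> = i k) > 0 \<longrightarrow>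
        \<P>(\<omega> in M. Y s \<omega> = j \<bar> \<forall>k\<le>n. Y (t k) \<omega> = i k) = p (s - t n) (i n) j)"

definition markov_chain ::
    "'a measure \<Rightarrow> nat set \<Rightarrow> (nat \<Rightarrow> nat \<Rightarrow> real) \<Rightarrow> (nat \<Rightarrow> 'a \<Rightarrow> nat) \<Rightarrow> bool" where
  "markov_chain M S P X \<longleftrightarrow>
     prob_space M \<and>
     (\<forall>k. X k \<in> M \<rightarrow>\<^sub>M count_space S) \<and>
     (\<forall>k (i :: nat \<Rightarrow> nat). \<forall>j\<in>S.
        \<P>(\<omega> in M. \<forall>m\<le>k. X m \<omega> = i m) > 0 \<longrightarrow>
        \<P>(\<omega> in M. X (Suc k) \<omega> = j \<bar> \<forall>m\<le>k. X m \<omega> = i m) = P (i k) j)"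

text \<open>
  \<open>step_matrix lam p h\<close> has the diagonal entries \<open>exp (- lam i * h)\<close> (no jump at all up to time
  \<open>h\<close>) and the off-diagonal entries \<open>p h i j\<close>.  Its rows sum to
  \<open>1 - (p h i i - exp (- lam i * h))\<close>.  Excursions that leave \<open>i\<close> and are back at time \<open>h\<close> are
  counted by no entry, so if all jump rates are positive and \<open>h > 0\<close>, then this is less than
  \<open>1\<close>.  Such a substochastic matrix is the transition matrix of a chain with killing: the state
  \<open>0\<close>, not a member of the state space \<open>{1..}\<close>, serves as the absorbing cemetery and receives the
  missing mass.  If the rows do sum to \<open>1\<close>, then \<open>0\<close> is not reached from \<open>{1..}\<close> (almost surely).
\<close>

definition step_matrix ::
    "(nat \<Rightarrow> real) \<Rightarrow> (real \<Rightarrow> nat \<Rightarrow> nat \<Rightarrow> real) \<Rightarrow> real \<Rightarrow> nat \<Rightarrow> nat \<Rightarrow> real" where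
  "step_matrix lam p h i j = (if i = j then exp (- lam i * h) else p h i j)"

definition with_cemetery :: "(nat \<Rightarrow> nat \<Rightarrow> real) \<Rightarrow> nat \<Rightarrow> nat \<Rightarrow> real" where
  "with_cemetery P i j =
     (if i = 0 then of_bool (j = 0)
      else if j = 0 then 1 - (\<Sum>\<^sub>\<infinity>k\<in>{1..}. P i k)
      else P i j)"

definition path_on :: "real \<Rightarrow> (real \<Rightarrow> 'a \<Rightarrow> nat) \<Rightarrow> 'a \<Rightarrow> (real \<Rightarrow> real)" where
  "path_on T X \<omega> = (\<lambda>t\<in>{0..T}. real (X t \<omega>))"

definition continuous_time :: "real \<Rightarrow> nat \<Rightarrow> (nat \<Rightarrow> 'a \<Rightarrow> nat) \<Rightarrow> real \<Rightarrow> 'a \<Rightarrow> nat" where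
  "continuous_time T N X t = X (nat \<lfloor>t * real N / T\<rfloor>)"

end

theory Submission
  imports Defs
begin

text \<open>
  With \<open>h = T / N\<close>, compare the chain with the skeleton \<open>k \<mapsto> Y (k h)\<close>, a Markov chain with one-step
  matrix \<open>p h\<close>.  The step matrix is entrywise below \<open>p h\<close>, so on trajectories that avoid the cemetery
  the law of the chain is below the law of the skeleton.  The missing mass per step is
  \<open>p h i i - exp (- lam i h)\<close>, at most \<open>(sup lam)\<^sup>2 h\<^sup>2\<close> since leaving \<open>i\<close> and being back at time \<open>h\<close> takes two
  jumps.  Hence the two laws differ in total variation by \<open>O(N h\<^sup>2) = O(1 / N)\<close>.  The discretised path of
  the skeleton converges to the path of \<open>Y\<close> in the Skorokhod metric for every outcome, because a
  small time change moves the finitely many jump times to the next grid points; dominated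
  convergence concludes.
\<close>

section \<open>Discretisation of integer-valued cadlag paths\<close>

text \<open>Chain and jump process live on unrelated probability spaces and no coupling is built:
  only the laws of trajectories up to index \<open>N\<close> are compared. These are lists over
  \<open>nat\<close>, a countable type, so their laws are determined by the atoms and every function
  of a trajectory is measurable. Measurability is the other obstacle: the sigma-algebra is generated
  by the Skorokhod-open sets, not by coordinate projections. The discretised paths are measurable
  because they factor through such lists; the path of \<open>Y\<close> inherits this as their
  pointwise limit. The comparison of chain and skeleton sees the test function only through its
  bound \<open>B\<close>; continuity enters with the limit of the skeleton. The value
  \<open>exp (- lam i * h)\<close> is never read off the paths of \<open>Y\<close>: the lower and
  the upper estimate of \<open>p h i i\<close> both come from the Chapman-Kolmogorov equation and
  the derivative at \<open>0\<close>, by cutting a time interval into \<open>n\<close> pieces and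
  letting \<open>n\<close> grow.\<close>

lemma cadlag_on_subset:
  assumes "cadlag_on S x" "R \<subseteq> S"
  shows "cadlag_on R x"
  unfolding cadlag_on_def
proof (intro conjI ballI)
  fix t assume "t \<in> R"
  then have t: "t \<in> S" using assms(2) by blast
  show "(x \<longlongrightarrow> x t) (at t within R \<inter> {t<..})"
    using assms t unfolding cadlag_on_def by (meson Int_mono order_refl tendsto_within_subset)
  show "\<exists>l. (x \<longlongrightarrow> l) (at t within R \<inter> {..<t})"
    using assms t unfolding cadlag_on_def by (meson Int_mono order_refl tendsto_within_subset)
qed

lemma cadlag_on_cong:
  assumes "\<And>t. t \<in> S \<Longrightarrow> x t = y t" "cadlag_on S x"
  shows "cadlag_on S y"
proof -
  have "((x \<longlongrightarrow> l) (at t within S \<inter> A)) = ((y \<longlongrightarrow> l) (at t within S \<inter> A))" for l t A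
    by (rule tendsto_cong) (auto simp: eventually_at_filter assms(1))
  then show ?thesis using assms unfolding cadlag_on_def by simp
qed

lemma cadlag_on_step:
  fixes x :: "real \<Rightarrow> real"
  assumes "\<And>t. t \<in> S \<Longrightarrow> \<exists>d>0. (\<forall>s\<in>S. t < s \<and> s < t + d \<longrightarrow> x s = x t) \<and>
      (\<exists>l. \<forall>s\<in>S. t - d < s \<and> s < t \<longrightarrow> x s = l)"
  shows "cadlag_on S x"
  unfolding cadlag_on_def
proof (intro conjI ballI)
  fix t assume "t \<in> S"
  then obtain d l where d: "d > 0" and r: "\<forall>s\<in>S. t < s \<and> s < t + d \<longrightarrow> x s = x t"
    and l: "\<forall>s\<in>S. t - d < s \<and> s < t \<longrightarrow> x s = l"
    using assms by blast
  have "\<forall>\<^sub>F s in at t within S \<inter> {t<..}. x s = x t"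
    unfolding eventually_at using d r by (intro exI[of _ d]) (auto simp: dist_real_def)
  then show "(x \<longlongrightarrow> x t) (at t within S \<inter> {t<..})"
    by (rule tendsto_eventually)
  have "\<forall>\<^sub>F s in at t within S \<inter> {..<t}. x s = l"
    unfolding eventually_at using d l by (intro exI[of _ d]) (auto simp: dist_real_def)
  then show "\<exists>l. (x \<longlongrightarrow> l) (at t within S \<inter> {..<t})"
    using tendsto_eventually by blast
qed

text \<open>Two naturals at distance less than \<open>1/2\<close> from the same real number are
  equal, so both one-sided limits become constancy. To the left of \<open>t\<close> the constant
  value may differ from \<open>y t\<close>, hence the separate clause comparing \<open>r\<close> and
  \<open>s\<close>.\<close>

lemma cadlag_on_nat_locally_constant:
  fixes y :: "real \<Rightarrow> nat"
  assumes "cadlag_on S (\<lambda>t. real (y t))" "t \<in> S"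
  obtains d where "d > 0" "\<And>s. s \<in> S \<Longrightarrow> t \<le> s \<Longrightarrow> s < t + d \<Longrightarrow> y s = y t"
    "\<And>r s. \<lbrakk>r \<in> S; s \<in> S; t - d < r; r < t; t - d < s; s < t\<rbrakk> \<Longrightarrow> y r = y s"
proof -
  have near: "m = n" if "dist (real m) l < 1/2" "dist (real n) l < 1/2" for m n l
  proof -
    have "dist (real m) (real n) < 1" using that dist_triangle_half_r[of l "real m" 1 "real n"]
      by (simp add: dist_commute)
    then show ?thesis by (simp add: dist_real_def)
  qed
  have right: "((\<lambda>t. real (y t)) \<longlongrightarrow> real (y t)) (at t within S \<inter> {t<..})"
    using assms by (simp add: cadlag_on_def)
  obtain l where left: "((\<lambda>t. real (y t)) \<longlongrightarrow> l) (at t within S \<inter> {..<t})"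
    using assms by (auto simp: cadlag_on_def)
  obtain d1 where d1: "d1 > 0"
    "\<And>s. s \<in> S \<inter> {t<..} \<Longrightarrow> dist s t < d1 \<Longrightarrow> dist (real (y s)) (real (y t)) < 1/2"
    using tendstoD[OF right, of "1/2"] by (auto simp: eventually_at)
  obtain d2 where d2: "d2 > 0"
    "\<And>s. s \<in> S \<inter> {..<t} \<Longrightarrow> dist s t < d2 \<Longrightarrow> dist (real (y s)) l < 1/2"
    using tendstoD[OF left, of "1/2"] by (auto simp: eventually_at)
  show thesis
  proof (rule that[of "min d1 d2"])
    show "min d1 d2 > 0" using d1 d2 by simp
    fix s assume "s \<in> S" "t \<le> s" "s < t + min d1 d2"
    then show "y s = y t"
      using d1(2)[of s] near[of "y s" "real (y t)" "y t"] by (cases "s = t") (auto simp: dist_real_def)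
  next
    fix r s assume "r \<in> S" "s \<in> S" "t - min d1 d2 < r" "r < t" "t - min d1 d2 < s" "s < t"
    then show "y r = y s"
      using d2(2)[of r] d2(2)[of s] by (intro near[of _ l]) (auto simp: dist_real_def)
  qed
qed

text \<open>\<open>C\<close> consists of the centres of a finite subcover by neighbourhoods as in
  the previous lemma; it contains every jump time, possibly among other points. The condition on
  \<open>s\<close> and \<open>t\<close> excludes centres from the interval between them, right end
  included, since a cadlag path takes its new value at the jump itself.\<close>

lemma cadlag_on_nat_partition:
  fixes y :: "real \<Rightarrow> nat"
  assumes "cadlag_on {0..T} (\<lambda>t. real (y t))"
  obtains C where "finite C" "C \<subseteq> {0..T}"
    "\<And>s t. \<lbrakk>s \<in> {0..T}; t \<in> {0..T}; \<And>c. c \<in> C \<Longrightarrow> c \<le> s \<longleftrightarrow> c \<le> t\<rbrakk> \<Longrightarrow> y s = y t"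
proof -
  define good where "good t d \<longleftrightarrow> d > 0 \<and> (\<forall>s\<in>{0..T}. t \<le> s \<and> s < t + d \<longrightarrow> y s = y t) \<and>
     (\<forall>r\<in>{0..T}. \<forall>s\<in>{0..T}. t - d < r \<and> r < t \<and> t - d < s \<and> s < t \<longrightarrow> y r = y s)" for t d
  have "\<exists>d. good t d" if "t \<in> {0..T}" for t
    using cadlag_on_nat_locally_constant[OF assms that] unfolding good_def by metis
  then obtain d where good: "\<And>t. t \<in> {0..T} \<Longrightarrow> good t (d t)" by metis
  then have d: "\<And>t. t \<in> {0..T} \<Longrightarrow> d t > 0"
    and right: "\<And>t s. t \<in> {0..T} \<Longrightarrow> s \<in> {0..T} \<Longrightarrow> t \<le> s \<Longrightarrow> s < t + d t \<Longrightarrow> y s = y t"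
    and left: "\<And>t r s. t \<in> {0..T} \<Longrightarrow> r \<in> {0..T} \<Longrightarrow> s \<in> {0..T} \<Longrightarrow> t - d t < r \<Longrightarrow> r < t \<Longrightarrow>
       t - d t < s \<Longrightarrow> s < t \<Longrightarrow> y r = y s"
    unfolding good_def by blast+
  obtain C where C: "C \<subseteq> {0..T}" "finite C" "{0..T} \<subseteq> (\<Union>t\<in>C. ball t (d t))"
  proof (rule compactE_image)
    show "compact {0..T}" "open (ball t (d t))" for t by simp_all
    show "{0..T} \<subseteq> (\<Union>t\<in>{0..T}. ball t (d t))"
      using d by (auto intro!: bexI)
  qed
  have const: "y s = y t" if st: "s \<in> {0..T}" "t \<in> {0..T}" "s \<le> t"
    and sides: "\<And>c. c \<in> C \<Longrightarrow> c \<le> s \<longleftrightarrow> c \<le> t" for s t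
  proof (rule connected_local_const[where A="{s..t}"])
    show "connected {s..t}" "s \<in> {s..t}" "t \<in> {s..t}" using st by auto
    show "\<forall>u\<in>{s..t}. \<forall>\<^sub>F v in at u within {s..t}. y u = y v"
    proof
      fix u assume u: "u \<in> {s..t}"
      then have uT: "u \<in> {0..T}" using st by auto
      then obtain c where c: "c \<in> C" "u \<in> ball c (d c)" using C by blast
      then have cT: "c \<in> {0..T}" using C by blast
      have same: "y u = y v" if v: "v \<in> {s..t}" "v \<in> ball c (d c)" for v
      proof -
        have vT: "v \<in> {0..T}" using v st by auto
        show ?thesis
        \<comment> \<open>No centre lies in \<open>(s, t]\<close>, so \<open>{s..t}\<close> is
          either entirely to the right of \<open>c\<close> (or starts at \<open>c\<close>) or
          strictly to its left; on each side \<open>y\<close> is constant within the ball.\<close>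
        proof (cases "c \<le> s")
          case True
          then show ?thesis using right[OF cT uT] right[OF cT vT] u v c
            by (auto simp: dist_real_def)
        next
          case False
          then have "t < c" using sides c by auto
          then show ?thesis using left[OF cT uT vT] u v c by (auto simp: dist_real_def)
        qed
      qed
      have "\<forall>\<^sub>F v in at u within {s..t}. v \<in> ball c (d c)"
        using c unfolding eventually_at_topological by (intro exI[of _ "ball c (d c)"]) auto
      moreover have "\<forall>\<^sub>F v in at u within {s..t}. v \<in> {s..t}"
        by (auto simp: eventually_at_filter)
      ultimately show "\<forall>\<^sub>F v in at u within {s..t}. y u = y v"
        by eventually_elim (rule same)
    qed
  qed
  show thesis
  proof (rule that[OF C(2,1)])
    fix s t assume st: "s \<in> {0..T}" "t \<in> {0..T}" and sides: "\<And>c. c \<in> C \<Longrightarrow> c \<le> s \<longleftrightarrow> c \<le> t"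
    show "y s = y t"
    proof (cases "s \<le> t")
      case True
      show ?thesis by (rule const[OF st True sides])
    next
      case False
      then have "t \<le> s" by simp
      from const[OF st(2,1) this sides[symmetric]] show ?thesis by simp
    qed
  qed
qed

lemma finite_real_separated:
  fixes A :: "real set"
  assumes "finite A"
  obtains w where "w > 0" "\<And>a b. a \<in> A \<Longrightarrow> b \<in> A \<Longrightarrow> a \<noteq> b \<Longrightarrow> w \<le> \<bar>a - b\<bar>"
proof -
  \<comment> \<open>The element \<open>1\<close> keeps the set nonempty when \<open>A\<close> has at
    most one point; removing \<open>0\<close> discards the pairs with \<open>a = b\<close>.\<close>
  let ?D = "insert 1 ((\<lambda>(a, b). \<bar>a - b\<bar>) ` (A \<times> A) - {0})"
  have fin: "finite ?D" using assms by simp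
  show thesis
  proof (rule that[of "Min ?D"])
    show "Min ?D > 0" using fin by (subst Min_gr_iff) auto
    show "Min ?D \<le> \<bar>a - b\<bar>" if "a \<in> A" "b \<in> A" "a \<noteq> b" for a b
      using fin that by (intro Min_le) force+
  qed
qed

text \<open>A slope below \<open>1\<close> cannot outweigh that of the identity, which gives strict
  monotonicity; the zeros of \<open>g\<close> at the end points and the intermediate value theorem
  give the image.\<close>

lemma time_changes_Lipschitz_perturbation:
  fixes g :: "real \<Rightarrow> real"
  assumes "T \<ge> 0" and K: "K < 1" and lip: "\<And>s t. \<bar>g s - g t\<bar> \<le> K * \<bar>s - t\<bar>"
    and "g 0 = 0" "g T = 0"
  shows "(\<lambda>t. t + g t) \<in> time_changes T"
proof -
  have mono: "s + g s < t + g t" if "s < t" for s t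
  proof -
    have "K * \<bar>s - t\<bar> < 1 * \<bar>s - t\<bar>" using that K by (intro mult_strict_right_mono) auto
    then have "\<bar>g s - g t\<bar> < t - s" using order.strict_trans1[OF lip] that by fastforce
    then show ?thesis by linarith
  qed
  have "K \<ge> 0" using lip[of 0 1] by auto
  then have "K-lipschitz_on UNIV g"
    using lip by (auto simp: lipschitz_on_def dist_real_def)
  then have "continuous_on UNIV g" by (rule lipschitz_on_continuous_on)
  then have cont: "continuous_on {0..T} (\<lambda>t. t + g t)"
    by (intro continuous_intros) (auto intro: continuous_on_subset)
  have "(\<lambda>t. t + g t) ` {0..T} = {0..T}"
  proof
    show "(\<lambda>t. t + g t) ` {0..T} \<subseteq> {0..T}"
    proof
      fix u assume "u \<in> (\<lambda>t. t + g t) ` {0..T}"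
      then obtain t where t: "u = t + g t" "0 \<le> t" "t \<le> T" by auto
      then show "u \<in> {0..T}"
        using mono[of 0 t] mono[of t T] assms by (cases "t = 0"; cases "t = T") auto
    qed
    show "{0..T} \<subseteq> (\<lambda>t. t + g t) ` {0..T}"
    proof
      fix u assume "u \<in> {0..T}"
      then obtain t where "0 \<le> t" "t \<le> T" "t + g t = u"
        using IVT'[of "\<lambda>t. t + g t" 0 u T] cont assms by auto
      then show "u \<in> (\<lambda>t. t + g t) ` {0..T}" by auto
    qed
  qed
  then show ?thesis
    using mono cont by (auto simp: time_changes_def strict_mono_on_def)
qed

text \<open>Each \<open>c\<close> is moved to \<open>\<sigma> c\<close> by adding a multiple of a tent function centred at \<open>c\<close>; the
  tents are narrow enough to vanish at all other points of \<open>C\<close> and at the end points.\<close>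

lemma interpolating_time_change:
  assumes "T > 0" "finite C" "C \<subseteq> {0..T}"
  obtains K where "K > 0"
    "\<And>\<sigma> \<delta>. \<lbrakk>\<And>c. c \<in> C \<Longrightarrow> \<bar>\<sigma> c - c\<bar> \<le> \<delta>; K * \<delta> < 1; \<delta> \<ge> 0;
       0 \<in> C \<Longrightarrow> \<sigma> 0 = 0; T \<in> C \<Longrightarrow> \<sigma> T = T\<rbrakk> \<Longrightarrow>
     \<exists>\<mu>\<in>time_changes T. (\<forall>c\<in>C. \<mu> c = \<sigma> c) \<and> (\<forall>t\<in>{0..T}. \<bar>\<mu> t - t\<bar> \<le> K * \<delta>)"
proof -
  obtain w0 where w0: "w0 > 0"
    "\<And>a b. a \<in> C \<union> {0, T} \<Longrightarrow> b \<in> C \<union> {0, T} \<Longrightarrow> a \<noteq> b \<Longrightarrow> w0 \<le> \<bar>a - b\<bar>"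
    using finite_real_separated[of "C \<union> {0, T}"] assms by auto
  \<comment> \<open>The cap at \<open>1\<close> gives \<open>card C \<le> card C / w\<close>, so
    that one \<open>K\<close> bounds both the slope and the size of the perturbation.\<close>
  define w where "w = min w0 1"
  have w: "w > 0" "w \<le> 1"
    and sep: "\<And>a b. a \<in> C \<union> {0, T} \<Longrightarrow> b \<in> C \<union> {0, T} \<Longrightarrow> a \<noteq> b \<Longrightarrow> w \<le> \<bar>a - b\<bar>"
    using w0(1) order_trans[OF min.cobounded1 w0(2)] unfolding w_def by simp_all
  define tent where "tent c t = max 0 (1 - \<bar>t - c\<bar> / w)" for c t :: real
  have tent_self: "tent c c = 1" for c by (simp add: tent_def)
  have tent_other: "tent c t = 0" if "c \<in> C" "t \<in> C \<union> {0, T}" "t \<noteq> c" for c t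
    using sep[of t c] that w by (auto simp: tent_def field_simps)
  have tent_bound: "\<bar>tent c t\<bar> \<le> 1" for c t using w by (auto simp: tent_def)
  have tent_lip: "\<bar>tent c s - tent c t\<bar> \<le> \<bar>s - t\<bar> / w" for c s t
  proof -
    have "\<bar>tent c s - tent c t\<bar> \<le> \<bar>\<bar>s - c\<bar> / w - \<bar>t - c\<bar> / w\<bar>" by (auto simp: tent_def max_def)
    also have "\<dots> = \<bar>\<bar>s - c\<bar> - \<bar>t - c\<bar>\<bar> / w" using w by (simp add: diff_divide_distrib[symmetric])
    also have "\<dots> \<le> \<bar>s - t\<bar> / w" using w by (intro divide_right_mono) auto
    finally show ?thesis .
  qed
  \<comment> \<open>Each of the \<open>card C\<close> tents has slope at most \<open>1 / w\<close>;
    the extra \<open>1\<close> keeps \<open>K\<close> positive when \<open>C\<close> is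
    empty.\<close>
  define K where "K = (card C + 1) / w"
  have KC: "real (card C) / w \<le> K" using w by (auto simp: K_def field_simps)
  show thesis
  proof (rule that[of K])
    show "K > 0" using w by (auto simp: K_def)
    fix \<sigma> :: "real \<Rightarrow> real" and \<delta> :: real
    assume \<sigma>: "\<And>c. c \<in> C \<Longrightarrow> \<bar>\<sigma> c - c\<bar> \<le> \<delta>" and \<delta>: "K * \<delta> < 1" "\<delta> \<ge> 0"
      and ends: "0 \<in> C \<Longrightarrow> \<sigma> 0 = 0" "T \<in> C \<Longrightarrow> \<sigma> T = T"
    define g where "g t = (\<Sum>c\<in>C. (\<sigma> c - c) * tent c t)" for t
    have at: "g t = \<sigma> t - t" if "t \<in> C" for t
    proof -
      have "g t = (\<Sum>c\<in>C. if c = t then \<sigma> t - t else 0)"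
        unfolding g_def using that tent_self tent_other by (intro sum.cong) auto
      then show ?thesis using assms that by simp
    qed
    have away: "g t = 0" if "t \<in> {0, T}" "t \<notin> C" for t
      unfolding g_def using that tent_other by (intro sum.neutral) auto
    have g0: "g 0 = 0" using at[of 0] away[of 0] ends by auto
    have gT: "g T = 0" using at[of T] away[of T] ends by auto
    have lip: "\<bar>g s - g t\<bar> \<le> K * \<delta> * \<bar>s - t\<bar>" for s t
    proof -
      have "\<bar>g s - g t\<bar> = \<bar>\<Sum>c\<in>C. (\<sigma> c - c) * (tent c s - tent c t)\<bar>"
        by (simp add: g_def sum_subtractf right_diff_distrib)
      also have "\<dots> \<le> (\<Sum>c\<in>C. \<delta> * (\<bar>s - t\<bar> / w))"
        using \<sigma> tent_lip \<delta>
        by (intro order_trans[OF sum_abs] sum_mono) (simp only: abs_mult, intro mult_mono, auto)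
      also have "\<dots> = (real (card C) / w) * (\<delta> * \<bar>s - t\<bar>)" by simp
      also have "\<dots> \<le> K * (\<delta> * \<bar>s - t\<bar>)" using KC \<delta> by (intro mult_right_mono) auto
      finally show ?thesis by (simp add: mult.assoc)
    qed
    have bd: "\<bar>g t\<bar> \<le> K * \<delta>" for t
    proof -
      have "\<bar>g t\<bar> \<le> (\<Sum>c\<in>C. \<delta> * 1)"
        unfolding g_def using \<sigma> tent_bound \<delta>
        by (intro order_trans[OF sum_abs] sum_mono) (simp add: abs_mult mult_mono del: mult_1_right)
      also have "\<dots> = card C * \<delta>" by simp
      also have "\<dots> \<le> K * \<delta>"
      proof (rule mult_right_mono[OF _ \<delta>(2)])
        have "w * real (card C) \<le> 1 * real (card C)" using w by (intro mult_right_mono) auto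
        then show "real (card C) \<le> K" using w by (simp add: K_def field_simps)
      qed
      finally show ?thesis .
    qed
    have "(\<lambda>t. t + g t) \<in> time_changes T"
      using time_changes_Lipschitz_perturbation[of T "K * \<delta>" g] lip g0 gT \<delta> assms by auto
    then show "\<exists>\<mu>\<in>time_changes T. (\<forall>c\<in>C. \<mu> c = \<sigma> c) \<and> (\<forall>t\<in>{0..T}. \<bar>\<mu> t - t\<bar> \<le> K * \<delta>)"
      using at bd by (intro bexI[of _ "\<lambda>t. t + g t"]) auto
  qed
qed

text \<open>Defined for a deterministic sequence, so that the chain, the skeleton of
  \<open>Y\<close> and a list of states can all be inserted for \<open>z\<close>.\<close>

definition grid_path :: "real \<Rightarrow> nat \<Rightarrow> (nat \<Rightarrow> nat) \<Rightarrow> real \<Rightarrow> real" where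
  "grid_path T N z = (\<lambda>t\<in>{0..T}. real (z (nat \<lfloor>t * real N / T\<rfloor>)))"

lemma grid_path_in_cadlag_space:
  assumes "T > 0"
  shows "grid_path T N z \<in> cadlag_space T"
proof -
  have "cadlag_on {0..T} (\<lambda>t. real (z (nat \<lfloor>t * real N / T\<rfloor>)))"
  proof (rule cadlag_on_step)
    fix t assume t: "t \<in> {0..T}"
    show "\<exists>d>0. (\<forall>s\<in>{0..T}. t < s \<and> s < t + d \<longrightarrow>
        real (z (nat \<lfloor>s * real N / T\<rfloor>)) = real (z (nat \<lfloor>t * real N / T\<rfloor>))) \<and>
      (\<exists>l. \<forall>s\<in>{0..T}. t - d < s \<and> s < t \<longrightarrow> real (z (nat \<lfloor>s * real N / T\<rfloor>)) = l)"
    proof (cases "N = 0")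
      case True
      then show ?thesis by (intro exI[of _ 1]) auto
    next
      case False
      define c where "c = real N / T"
      have c: "c > 0" using False assms by (simp add: c_def)
      \<comment> \<open>The integers \<lfloor>c * t\<rfloor> + 1 and \<lceil>c * t\<rceil> - 1 are
        the nearest ones strictly above and strictly below \<open>c * t\<close>, also when
        \<open>c * t\<close> is an integer; \<open>d\<close> is the smaller distance, scaled back to
        time.\<close>
      define d where "d = min (of_int \<lfloor>c * t\<rfloor> + 1 - c * t) (c * t - (of_int \<lceil>c * t\<rceil> - 1)) / c"
      have d: "d > 0" using c unfolding d_def by (intro divide_pos_pos) (auto, linarith+)
      have cd: "c * d \<le> of_int \<lfloor>c * t\<rfloor> + 1 - c * t" "c * d \<le> c * t - (of_int \<lceil>c * t\<rceil> - 1)"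
        using c by (auto simp: d_def)
      have 1: "\<lfloor>c * s\<rfloor> = \<lfloor>c * t\<rfloor>" if "t < s" "s < t + d" for s
      proof -
        have "c * t < c * s" "c * s < c * t + c * d" using that c by (auto simp: distrib_left[symmetric])
        then show ?thesis using cd(1) by (intro floor_unique) linarith+
      qed
      have 2: "\<lfloor>c * s\<rfloor> = \<lceil>c * t\<rceil> - 1" if "t - d < s" "s < t" for s
      proof -
        have "c * (t - d) < c * s" "c * s < c * t" using that c by auto
        then have "c * t - c * d < c * s" "c * s < c * t" by (auto simp: right_diff_distrib)
        then show ?thesis using cd(2) by (intro floor_unique) (simp_all, linarith+)
      qed
      have "s * real N / T = c * s" for s by (simp add: c_def)
      then show ?thesis using d 1 2 by (intro exI[of _ d]) auto
    qed
  qed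
  then have "cadlag_on {0..T} (grid_path T N z)"
    by (rule cadlag_on_cong[rotated]) (simp add: grid_path_def)
  then show ?thesis by (simp add: cadlag_space_def grid_path_def)
qed

text \<open>The largest index read is \<open>N\<close>, at \<open>t = T\<close>. A list of
  \<open>N + 1\<close> states therefore carries the whole path.\<close>

lemma grid_path_cong:
  assumes "T > 0" "\<And>k. k \<le> N \<Longrightarrow> y k = z k"
  shows "grid_path T N y = grid_path T N z"
proof -
  have "nat \<lfloor>t * real N / T\<rfloor> \<le> N" if "t \<in> {0..T}" for t
  proof -
    have "t * real N / T \<le> real N" using that assms(1) by (simp add: divide_le_eq mult.commute mult_right_mono)
    then have "\<lfloor>t * real N / T\<rfloor> \<le> int N" by linarith
    then show ?thesis by linarith
  qed
  then show ?thesis using assms(2) by (auto simp: grid_path_def)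
qed

text \<open>The jump time \<open>c\<close> of \<open>y\<close> is seen by the discretised path at the next grid point \<open>\<sigma> c\<close>, so
  the time change that maps each \<open>c\<close> to \<open>\<sigma> c\<close> matches the two paths exactly.\<close>

lemma grid_path_limit:
  fixes y :: "real \<Rightarrow> nat"
  assumes T: "T > 0" and y: "cadlag_on {0..T} (\<lambda>t. real (y t))"
  shows "limitin (skorokhod_topology T) (\<lambda>N. grid_path T N (\<lambda>k. y (real k * (T / real N))))
           (\<lambda>t\<in>{0..T}. real (y t)) sequentially"
proof -
  interpret S: Metric_space "cadlag_space T" "skorokhod_dist T" by (rule Metric_space_skorokhod)
  have lim_in: "(\<lambda>t\<in>{0..T}. real (y t)) \<in> cadlag_space T"
    using cadlag_on_cong[OF _ y, of "\<lambda>t\<in>{0..T}. real (y t)"] by (simp add: cadlag_space_def)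
  obtain C where C: "finite C" "C \<subseteq> {0..T}"
    and const: "\<And>s t. \<lbrakk>s \<in> {0..T}; t \<in> {0..T}; \<And>c. c \<in> C \<Longrightarrow> c \<le> s \<longleftrightarrow> c \<le> t\<rbrakk> \<Longrightarrow> y s = y t"
    using cadlag_on_nat_partition[OF y] by blast
  obtain K where K: "K > 0" "\<And>\<sigma> \<delta>. \<lbrakk>\<And>c. c \<in> C \<Longrightarrow> \<bar>\<sigma> c - c\<bar> \<le> \<delta>; K * \<delta> < 1; \<delta> \<ge> 0;
       0 \<in> C \<Longrightarrow> \<sigma> 0 = 0; T \<in> C \<Longrightarrow> \<sigma> T = T\<rbrakk> \<Longrightarrow>
     \<exists>\<mu>\<in>time_changes T. (\<forall>c\<in>C. \<mu> c = \<sigma> c) \<and> (\<forall>t\<in>{0..T}. \<bar>\<mu> t - t\<bar> \<le> K * \<delta>)"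
    using interpolating_time_change[OF T C] by blast
  let ?g = "\<lambda>N. grid_path T N (\<lambda>k. y (real k * (T / real N)))"
  have close: "skorokhod_close T (\<lambda>t\<in>{0..T}. real (y t)) (?g N) (K * (T / N))"
    if N: "N \<ge> 1" "K * (T / N) < 1" for N
  proof -
    define h where "h = T / real N"
    have h: "h > 0" "real N * h = T" using N T by (auto simp: h_def)
    define \<sigma> where "\<sigma> c = of_int \<lceil>c / h\<rceil> * h" for c
    have 1: "\<bar>\<sigma> c - c\<bar> \<le> h" for c
    proof -
      have "c / h \<le> of_int \<lceil>c / h\<rceil>" "of_int \<lceil>c / h\<rceil> \<le> c / h + 1" by linarith+
      then have "c / h * h \<le> \<sigma> c" "\<sigma> c \<le> (c / h + 1) * h"
        using h unfolding \<sigma>_def by (intro mult_right_mono; simp)+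
      then show ?thesis using h by (simp add: distrib_right)
    qed
    \<comment> \<open>Both end points lie on the grid and are fixed by rounding up, as
      \<open>interpolating_time_change\<close> demands.\<close>
    have "T / h = real N" using h by (simp add: field_simps)
    then have ends: "\<sigma> 0 = 0" "\<sigma> T = T" using h by (simp_all add: \<sigma>_def)
    obtain \<mu> where \<mu>: "\<mu> \<in> time_changes T" "\<And>c. c \<in> C \<Longrightarrow> \<mu> c = \<sigma> c"
      and b: "\<And>t. t \<in> {0..T} \<Longrightarrow> \<bar>\<mu> t - t\<bar> \<le> K * h"
      using K(2)[of \<sigma> h] 1 ends N h by (auto simp: h_def)
    have "real (y t) = ?g N (\<mu> t)" if t: "t \<in> {0..T}" for t
    proof -
      have mt: "\<mu> t \<in> {0..T}" using \<mu>(1) t by (auto simp: time_changes_def)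
      \<comment> \<open>\<open>k\<close> is the index that the discretised path reads at
        \<open>\<mu> t\<close> and \<open>s\<close> the corresponding sampling time, so the goal
        becomes \<open>y t = y s\<close>.\<close>
      define k where "k = \<lfloor>\<mu> t / h\<rfloor>"
      define s where "s = of_int k * h"
      have k: "k \<ge> 0" using mt h by (simp add: k_def)
      have "of_int k \<le> \<mu> t / h" by (simp add: k_def)
      then have "s \<le> \<mu> t" using h by (simp add: s_def pos_le_divide_eq)
      then have s: "s \<in> {0..T}" using k h mt by (auto simp: s_def)
      \<comment> \<open>Floor and ceiling are adjoint to the embedding of the integers: comparing
        \<open>c\<close> rounded up to the grid with \<open>\<mu> t\<close> amounts to comparing
        \<open>c\<close> with \<open>\<mu> t\<close> rounded down, which is
        \<open>s\<close>.\<close>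
      have "c \<le> t \<longleftrightarrow> c \<le> s" if c: "c \<in> C" for c
      proof -
        have cT: "c \<in> {0..T}" using c C by blast
        have sm: "strict_mono_on {0..T} \<mu>" using \<mu> by (simp add: time_changes_def)
        have "c \<le> t \<longleftrightarrow> \<mu> c \<le> \<mu> t"
          using strict_mono_on_less_eq[OF sm cT t] by simp
        also have "\<dots> \<longleftrightarrow> of_int \<lceil>c / h\<rceil> \<le> \<mu> t / h"
          using \<mu>(2)[OF c] h by (simp add: \<sigma>_def pos_le_divide_eq)
        also have "\<dots> \<longleftrightarrow> \<lceil>c / h\<rceil> \<le> k" by (simp add: k_def le_floor_iff)
        also have "\<dots> \<longleftrightarrow> c / h \<le> of_int k" by (simp add: ceiling_le_iff)
        also have "\<dots> \<longleftrightarrow> c \<le> s" using h by (simp add: s_def pos_divide_le_eq)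
        finally show ?thesis .
      qed
      then have "y t = y s" using const[OF t s] by blast
      moreover have "\<mu> t * real N / T = \<mu> t / h" by (simp add: h_def)
      ultimately show ?thesis using mt k
        by (simp add: grid_path_def s_def h_def[symmetric] k_def[symmetric])
    qed
    then have "\<forall>t\<in>{0..T}. \<bar>\<mu> t - t\<bar> \<le> K * h \<and> \<bar>(\<lambda>t\<in>{0..T}. real (y t)) t - ?g N (\<mu> t)\<bar> \<le> K * h"
      using b K(1) h by simp
    then show ?thesis using \<mu>(1) unfolding skorokhod_close_def h_def by blast
  qed
  have lim: "(\<lambda>N. K * (T / real N)) \<longlonglongrightarrow> 0"
    by (intro tendsto_mult_right_zero tendsto_divide_0[OF tendsto_const] filterlim_at_top_imp_at_infinity
        filterlim_real_sequentially)
  have "limitin S.mtopology ?g (\<lambda>t\<in>{0..T}. real (y t)) sequentially"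
    unfolding S.limitin_metric
  proof (intro conjI allI impI lim_in)
    fix e :: real assume "e > 0"
    \<comment> \<open>The bound \<open>1\<close> makes the time change of \<open>close\<close>
      available; the bound \<open>e\<close> is the target.\<close>
    then have "\<forall>\<^sub>F N in sequentially. K * (T / real N) < min e 1"
      using order_tendstoD(2)[OF lim, of "min e 1"] by auto
    then show "\<forall>\<^sub>F N in sequentially. ?g N \<in> cadlag_space T \<and>
        skorokhod_dist T (?g N) (\<lambda>t\<in>{0..T}. real (y t)) < e"
      using eventually_ge_at_top[of 1]
    proof eventually_elim
      case (elim N)
      have "skorokhod_dist T (?g N) (\<lambda>t\<in>{0..T}. real (y t)) \<le> K * (T / N)"
        using elim K(1) T
        by (intro skorokhod_dist_le grid_path_in_cadlag_space lim_in skorokhod_close_sym[OF close]) auto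
      then show ?case using elim grid_path_in_cadlag_space[OF T] by auto
    qed
  qed
  then show ?thesis by (simp add: skorokhod_topology_def)
qed

section \<open>Short-time bounds for the transition function\<close>

text \<open>Take logarithms: since \<open>f 0 = 1\<close>, \<open>n * ln (f (h / n))\<close> is
  \<open>h\<close> times a difference quotient of \<open>ln (f t)\<close> at \<open>0\<close>. The
  derivative is one-sided because transition functions are constrained at nonnegative times
  only.\<close>

lemma power_scaled_tendsto_exp:
  fixes f :: "real \<Rightarrow> real"
  assumes "f 0 = 1" and f: "(f has_real_derivative a) (at 0 within {0..})" and h: "h > 0"
  shows "(\<lambda>n. f (h / real n) ^ n) \<longlonglongrightarrow> exp (a * h)"
proof -
  have zero: "filterlim (\<lambda>n. h / real n) (at 0 within {0..}) sequentially"
    unfolding filterlim_at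
  proof
    show "\<forall>\<^sub>F n in sequentially. h / real n \<in> {0..} \<and> h / real n \<noteq> 0"
      using eventually_gt_at_top[of 0] by eventually_elim (use h in auto)
    show "(\<lambda>n. h / real n) \<longlonglongrightarrow> 0"
      by (intro tendsto_divide_0[OF tendsto_const] filterlim_at_top_imp_at_infinity
          filterlim_real_sequentially)
  qed
  have "((\<lambda>t. ln (f t)) has_real_derivative a) (at 0 within {0..})"
    using DERIV_chain2[OF DERIV_ln f] assms(1) by simp
  then have "((\<lambda>t. ln (f t) / t) \<longlongrightarrow> a) (at 0 within {0..})"
    using assms(1) by (simp add: has_field_derivative_iff)
  from filterlim_compose[OF this zero]
  have "(\<lambda>n. ln (f (h / real n)) / (h / real n)) \<longlonglongrightarrow> a" .
  then have "(\<lambda>n. exp (ln (f (h / real n)) / (h / real n) * h)) \<longlonglongrightarrow> exp (a * h)"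
    by (intro tendsto_intros)
  moreover have "(f \<longlongrightarrow> 1) (at 0 within {0..})"
    using DERIV_continuous[OF f] assms(1) by (simp add: continuous_within)
  then have "(\<lambda>n. f (h / real n)) \<longlonglongrightarrow> 1"
    by (rule filterlim_compose[OF _ zero])
  then have "\<forall>\<^sub>F n in sequentially. f (h / real n) > 0"
    by (rule order_tendstoD) simp
  then have "\<forall>\<^sub>F n in sequentially.
      exp (ln (f (h / real n)) / (h / real n) * h) = f (h / real n) ^ n"
    using eventually_gt_at_top[of 0]
  proof eventually_elim
    case (elim n)
    then have "ln (f (h / real n)) / (h / real n) * h = real n * ln (f (h / real n))"
      using h by simp
    then show ?case using elim by (simp only: exp_of_nat_mult exp_ln)
  qed
  ultimately show ?thesis by (rule Lim_transform_eventually)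
qed

lemma transition_function_split:
  assumes p: "transition_function p" and i: "i \<ge> 1" "t \<ge> 0"
  shows "((\<lambda>k. p t i k) has_sum (1 - p t i i)) ({1..} - {i})"
proof -
  have "(p t i has_sum 1) {1..}" using p i unfolding transition_function_def by blast
  moreover have "(p t i has_sum p t i i) {i}" using has_sum_finite[of "{i}" "p t i"] by simp
  ultimately show ?thesis using i by (intro has_sum_Diff) auto
qed

lemma transition_function_le_leave:
  assumes p: "transition_function p" and "i \<ge> 1" "j \<ge> 1" "j \<noteq> i" "t \<ge> 0"
  shows "p t i j \<le> 1 - p t i i"
proof -
  have "(p t i has_sum p t i j) {j}" using has_sum_finite[of "{j}" "p t i"] by simp
  moreover note transition_function_split[OF p \<open>i \<ge> 1\<close> \<open>t \<ge> 0\<close>]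
  ultimately show ?thesis
    by (rule has_sum_mono') (use assms in \<open>auto simp: transition_function_def\<close>)
qed

lemma transition_function_bounds:
  assumes p: "transition_function p" and "i \<ge> 1" "j \<ge> 1" "t \<ge> 0"
  shows "0 \<le> p t i j" "p t i j \<le> 1"
proof -
  have nn: "\<And>j. j \<ge> 1 \<Longrightarrow> 0 \<le> p t i j" using assms by (auto simp: transition_function_def)
  show "0 \<le> p t i j" using nn assms by blast
  have "0 \<le> 1 - p t i i"
    using transition_function_split[OF p \<open>i \<ge> 1\<close> \<open>t \<ge> 0\<close>] nn by (rule has_sum_nonneg) auto
  then show "p t i j \<le> 1"
    using transition_function_le_leave[OF p \<open>i \<ge> 1\<close> \<open>j \<ge> 1\<close> _ \<open>t \<ge> 0\<close>] nn[of i] assms(2)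
    by (cases "j = i") auto
qed

text \<open>Keep only the intermediate state \<open>i\<close> in the Chapman-Kolmogorov sum.\<close>

lemma transition_function_diag_supermult:
  assumes p: "transition_function p" and i: "i \<ge> 1" and "s \<ge> 0" "t \<ge> 0"
  shows "p s i i * p t i i \<le> p (s + t) i i"
proof -
  have "((\<lambda>k. p s i k * p t k i) has_sum p s i i * p t i i) {i}"
    using has_sum_finite[of "{i}" "\<lambda>k. p s i k * p t k i"] by simp
  moreover have "((\<lambda>k. p s i k * p t k i) has_sum p (s + t) i i) {1..}"
    using assms unfolding transition_function_def by blast
  ultimately show ?thesis
    by (rule has_sum_mono') (use assms transition_function_bounds[OF p] in auto)
qed

text \<open>Supermultiplicativity gives \<open>p (t / n) i i ^ n \<le> p t i i\<close>, and the left
  side tends to the exponential.\<close>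

lemma exp_le_transition_diag:
  assumes p: "transition_function p" and i: "i \<ge> 1"
    and der: "((\<lambda>t. p t i i) has_real_derivative - l) (at 0 within {0..})" and t: "t \<ge> 0"
  shows "exp (- l * t) \<le> p t i i"
proof (cases "t = 0")
  case True
  then show ?thesis using p i by (simp add: transition_function_def)
next
  case False
  have pow: "p d i i ^ n \<le> p (real n * d) i i" if "d \<ge> 0" for n d
  proof (induction n)
    case 0
    then show ?case using p i by (simp add: transition_function_def)
  next
    case (Suc n)
    have "p d i i ^ Suc n \<le> p d i i * p (real n * d) i i"
      using Suc transition_function_bounds[OF p i i that] by (simp add: mult_left_mono)
    also have "\<dots> \<le> p (d + real n * d) i i"
      using that by (intro transition_function_diag_supermult[OF p i]) auto
    finally show ?case by (simp add: algebra_simps)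
  qed
  have "p 0 i i = 1" using p i by (simp add: transition_function_def)
  then have "(\<lambda>n. p (t / real n) i i ^ n) \<longlonglongrightarrow> exp (- l * t)"
    using power_scaled_tendsto_exp[of "\<lambda>t. p t i i", OF _ der, of t] t False by simp
  moreover have "\<forall>\<^sub>F n in sequentially. p (t / real n) i i ^ n \<le> p t i i"
    using eventually_gt_at_top[of 0]
  proof eventually_elim
    case (elim n)
    then show ?case using pow[of "t / real n" n] t by simp
  qed
  ultimately show ?thesis by (rule tendsto_upperbound) simp
qed

text \<open>Being back at \<open>i\<close> after an excursion takes two jumps, which costs a factor \<open>h\<^sup>2\<close>: split
  \<open>[0, h]\<close> into \<open>n\<close> equal pieces and bound the mass of leaving \<open>i\<close> in the first piece and
  returning later.\<close>

lemma transition_diag_le_exp: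
  assumes p: "transition_function p" and i: "i \<ge> 1" and h: "h \<ge> 0"
    and der: "\<And>k. k \<ge> 1 \<Longrightarrow> ((\<lambda>t. p t k k) has_real_derivative - lam k) (at 0 within {0..})"
    and L: "\<And>k. k \<ge> 1 \<Longrightarrow> lam k \<le> L" "L \<ge> 0"
  shows "p h i i \<le> exp (- lam i * h) + L\<^sup>2 * h\<^sup>2"
proof (cases "h = 0")
  case True
  then show ?thesis using p i by (simp add: transition_function_def)
next
  case False
  \<comment> \<open>Combines the exponential lower bound with \<open>exp x \<ge> 1 + x\<close>;
    \<open>L\<close> makes it uniform in the state.\<close>
  have leave: "1 - p t k k \<le> L * t" if "k \<ge> 1" "t \<ge> 0" for k t
  proof -
    have "1 + (- lam k * t) \<le> p t k k"
      using exp_ge_add_one_self[of "- lam k * t"] exp_le_transition_diag[OF p that(1) der that(2)] that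
      by linarith
    moreover have "lam k * t \<le> L * t" using L that by (intro mult_right_mono) auto
    ultimately show ?thesis by simp
  qed
  \<comment> \<open>In the Chapman-Kolmogorov sum the states \<open>k\<close> other than
    \<open>i\<close> carry total mass at most \<open>L * d\<close> at time \<open>d\<close>, and the
    return probability \<open>p s k i\<close> is at most the mass leaving \<open>k\<close>, hence at
    most \<open>L * s\<close>.\<close>
  have step: "p (d + s) i i \<le> p d i i * p s i i + L * d * (L * s)" if d: "d \<ge> 0" "s \<ge> 0" for d s
  proof -
    have ck: "((\<lambda>k. p d i k * p s k i) has_sum p (d + s) i i) {1..}"
      using p i d unfolding transition_function_def by blast
    have "((\<lambda>k. p d i k * p s k i) has_sum p d i i * p s i i) {i}"
      using has_sum_finite[of "{i}" "\<lambda>k. p d i k * p s k i"] by simp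
    with ck have "((\<lambda>k. p d i k * p s k i) has_sum (p (d + s) i i - p d i i * p s i i)) ({1..} - {i})"
      using i by (intro has_sum_Diff) auto
    moreover have "((\<lambda>k. p d i k * (L * s)) has_sum (1 - p d i i) * (L * s)) ({1..} - {i})"
      by (intro has_sum_cmult_left transition_function_split[OF p i d(1)])
    moreover have "p d i k * p s k i \<le> p d i k * (L * s)" if "k \<in> {1..} - {i}" for k
      using that leave[of k s] transition_function_le_leave[OF p _ i, of k s] d
        transition_function_bounds[OF p i, of k d]
      by (intro mult_left_mono) auto
    ultimately have "p (d + s) i i - p d i i * p s i i \<le> (1 - p d i i) * (L * s)"
      by (rule has_sum_mono)
    also have "\<dots> \<le> L * d * (L * s)"
      using leave[OF i d(1)] L d by (intro mult_right_mono) auto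
    finally show ?thesis by simp
  qed
  \<comment> \<open>As \<open>p d i i \<le> 1\<close>, the errors of the pieces add up without
    amplification. For \<open>d = h / n\<close> their total is \<open>L\<^sup>2 * h\<^sup>2\<close>,
    independent of \<open>n\<close>.\<close>
  have pow: "p (real n * d) i i \<le> p d i i ^ n + real n * (L * d * (L * h))"
    if "d \<ge> 0" "real n * d \<le> h" for n d
    using that(2)
  proof (induction n)
    case 0
    then show ?case using p i by (simp add: transition_function_def)
  next
    case (Suc n)
    note b = transition_function_bounds[OF p i i that(1)]
    have nd: "real n * d \<le> h" using Suc.prems that(1) by (simp add: algebra_simps)
    have "p (real (Suc n) * d) i i \<le> p d i i * p (real n * d) i i + L * d * (L * (real n * d))"
      using step[of d "real n * d"] that(1) by (simp add: algebra_simps)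
    also have "\<dots> \<le> p d i i * (p d i i ^ n + real n * (L * d * (L * h))) + L * d * (L * h)"
      using Suc.IH[OF nd] b nd L that(1) by (intro add_mono mult_left_mono) auto
    also have "p d i i * (p d i i ^ n + real n * (L * d * (L * h))) \<le>
        p d i i ^ Suc n + real n * (L * d * (L * h))"
    proof -
      have "p d i i * (real n * (L * d * (L * h))) \<le> 1 * (real n * (L * d * (L * h)))"
        using b L that(1) h by (intro mult_right_mono) auto
      then show ?thesis by (simp add: distrib_left)
    qed
    finally show ?case by (simp add: algebra_simps)
  qed
  have "p 0 i i = 1" using p i by (simp add: transition_function_def)
  then have "(\<lambda>n. p (h / real n) i i ^ n) \<longlonglongrightarrow> exp (- lam i * h)"
    using power_scaled_tendsto_exp[of "\<lambda>t. p t i i", OF _ der[OF i], of h] h False by simp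
  then have "(\<lambda>n. p (h / real n) i i ^ n + L\<^sup>2 * h\<^sup>2) \<longlonglongrightarrow> exp (- lam i * h) + L\<^sup>2 * h\<^sup>2"
    by (intro tendsto_intros)
  moreover have "\<forall>\<^sub>F n in sequentially. p h i i \<le> p (h / real n) i i ^ n + L\<^sup>2 * h\<^sup>2"
    using eventually_gt_at_top[of 0]
  proof eventually_elim
    case (elim n)
    then show ?case using pow[of "h / real n" n] h by (simp add: power2_eq_square mult_ac)
  qed
  ultimately show ?thesis by (rule tendsto_lowerbound) simp
qed

text \<open>The off-diagonal mass \<open>1 - p h i i\<close> is the same as for \<open>p h\<close>,
  so the deficit of the row arises on the diagonal alone.\<close>

lemma with_cemetery_step_matrix_0:
  assumes p: "transition_function p" and i: "i \<ge> 1" and h: "h \<ge> 0"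
  shows "with_cemetery (step_matrix lam p h) i 0 = p h i i - exp (- lam i * h)"
proof -
  have "(step_matrix lam p h i has_sum (1 - p h i i)) ({1..} - {i})"
    using transition_function_split[OF p i h] by (rule has_sum_cong[THEN iffD1, rotated])
      (auto simp: step_matrix_def)
  moreover have "(step_matrix lam p h i has_sum exp (- lam i * h)) {i}"
    using has_sum_finite[of "{i}" "step_matrix lam p h i"] by (simp add: step_matrix_def)
  ultimately have "(step_matrix lam p h i has_sum (1 - p h i i + exp (- lam i * h))) ({1..} - {i} \<union> {i})"
    by (rule has_sum_Un_disjoint) auto
  moreover have "{1..} - {i} \<union> {i} = {1..}" using i by auto
  ultimately have "(\<Sum>\<^sub>\<infinity>k\<in>{1..}. step_matrix lam p h i k) = 1 - p h i i + exp (- lam i * h)"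
    by (simp add: infsumI)
  then show ?thesis using i by (simp add: with_cemetery_def)
qed

section \<open>Trajectories of chains\<close>

definition trajectory :: "(nat \<Rightarrow> 'a \<Rightarrow> nat) \<Rightarrow> nat \<Rightarrow> 'a \<Rightarrow> nat list" where
  "trajectory X n \<omega> = map (\<lambda>k. X k \<omega>) [0..<Suc n]"

lemma trajectory_eq_iff:
  "trajectory X n \<omega> = l \<longleftrightarrow> length l = Suc n \<and> (\<forall>k\<le>n. X k \<omega> = l ! k)"
  unfolding trajectory_def list_eq_iff_nth_eq
  by (auto simp del: upt_Suc)

lemma nth_trajectory: "k \<le> n \<Longrightarrow> trajectory X n \<omega> ! k = X k \<omega>"
  unfolding trajectory_def by (simp del: upt_Suc)

lemma set_trajectory: "set (trajectory X n \<omega>) = (\<lambda>k. X k \<omega>) ` {..n}"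
  unfolding trajectory_def by (auto simp del: upt_Suc)

lemma measurable_trajectory:
  assumes [measurable]: "\<And>k. X k \<in> M \<rightarrow>\<^sub>M count_space UNIV"
  shows "trajectory X n \<in> M \<rightarrow>\<^sub>M count_space UNIV"
  unfolding measurable_count_space_eq2_countable
proof safe
  fix l
  have "trajectory X n -` {l} \<inter> space M =
      {\<omega> \<in> space M. length l = Suc n \<and> (\<forall>k\<in>{..n}. X k \<omega> = l ! k)}"
    using trajectory_eq_iff[of X n _ l] by auto
  also have "\<dots> \<in> sets M" by measurable
  finally show "trajectory X n -` {l} \<inter> space M \<in> sets M" .
qed auto

text \<open>Multiplication rule along one fixed trajectory. Conditional probabilities are prescribed
  only after histories of positive probability; after a null history both sides of the recursion
  vanish.\<close>

lemma (in prob_space) prob_path: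
  fixes X :: "nat \<Rightarrow> 'a \<Rightarrow> nat"
  assumes X[measurable]: "\<And>k. X k \<in> M \<rightarrow>\<^sub>M count_space UNIV"
    and init: "AE \<omega> in M. X 0 \<omega> = x"
    and step: "\<And>k. \<P>(\<omega> in M. \<forall>m\<le>k. X m \<omega> = i m) > 0 \<Longrightarrow>
       \<P>(\<omega> in M. X (Suc k) \<omega> = i (Suc k) \<bar> \<forall>m\<le>k. X m \<omega> = i m) = P (i k) (i (Suc k))"
  shows "\<P>(\<omega> in M. \<forall>m\<le>k. X m \<omega> = i m) = of_bool (i 0 = x) * (\<Prod>m<k. P (i m) (i (Suc m)))"
proof (induction k)
  case 0
  have "\<P>(\<omega> in M. X 0 \<omega> = i 0) = \<P>(\<omega> in M. i 0 = x)"
    using init by (intro prob_eq_AE) auto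
  then show ?case by (auto simp: prob_space)
next
  case (Suc k)
  let ?A = "\<P>(\<omega> in M. \<forall>m\<le>k. X m \<omega> = i m)"
  have eq: "\<P>(\<omega> in M. \<forall>m\<le>Suc k. X m \<omega> = i m) =
      \<P>(\<omega> in M. X (Suc k) \<omega> = i (Suc k) \<and> (\<forall>m\<le>k. X m \<omega> = i m))"
    by (auto simp: le_Suc_eq intro!: arg_cong[where f=prob])
  have "\<P>(\<omega> in M. \<forall>m\<le>Suc k. X m \<omega> = i m) = ?A * P (i k) (i (Suc k))"
  proof (cases "?A > 0")
    case True
    then show ?thesis using step[OF True] unfolding eq cond_prob_def by (simp add: field_simps)
  next
    case False
    then have "?A = 0" using measure_nonneg[of M] by (simp add: antisym_conv3 less_le)
    moreover have "\<P>(\<omega> in M. \<forall>m\<le>Suc k. X m \<omega> = i m) \<le> ?A"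
      by (intro finite_measure_mono) auto
    ultimately show ?thesis using measure_nonneg[of M] by (simp add: order_antisym)
  qed
  then show ?case using Suc by simp
qed

lemma emeasure_eq_sum_fibres:
  fixes L :: "'a \<Rightarrow> 'c :: countable"
  assumes [measurable]: "L \<in> M \<rightarrow>\<^sub>M count_space UNIV" "E \<in> sets M"
  shows "emeasure M E = (\<integral>\<^sup>+ l. emeasure M {\<omega>\<in>E. L \<omega> = l} \<partial>count_space UNIV)"
proof -
  have fib: "{\<omega>\<in>E. L \<omega> = l} \<in> sets M" for l
  proof -
    have "{\<omega>\<in>E. L \<omega> = l} = E \<inter> {\<omega>\<in>space M. L \<omega> = l}"
      using sets.sets_into_space[OF assms(2)] by auto
    then show ?thesis by simp
  qed
  have "E = (\<Union>l. {\<omega>\<in>E. L \<omega> = l})" by auto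
  then show ?thesis
    using emeasure_UN_countable[of UNIV "\<lambda>l. {\<omega>\<in>E. L \<omega> = l}" M] fib
    by (auto simp: disjoint_family_on_def)
qed

text \<open>Union bound over the time of the first visit to \<open>z\<close>. The conditional bound
  refers to a complete history, so the event of a first visit at the next step is split into its
  countably many histories.\<close>

lemma (in prob_space) prob_absorbed_le:
  fixes X :: "nat \<Rightarrow> 'a \<Rightarrow> nat"
  assumes X[measurable]: "\<And>k. X k \<in> M \<rightarrow>\<^sub>M count_space UNIV"
    and init: "AE \<omega> in M. X 0 \<omega> \<noteq> z"
    and step: "\<And>k i. \<P>(\<omega> in M. \<forall>m\<le>k. X m \<omega> = i m) > 0 \<Longrightarrow> i k \<noteq> z \<Longrightarrow>
       \<P>(\<omega> in M. X (Suc k) \<omega> = z \<bar> \<forall>m\<le>k. X m \<omega> = i m) \<le> e"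
    and "e \<ge> 0"
  shows "\<P>(\<omega> in M. \<exists>m\<le>n. X m \<omega> = z) \<le> real n * e"
proof (induction n)
  case 0
  have "\<P>(\<omega> in M. X 0 \<omega> = z) = \<P>(\<omega> in M. False)"
    using init by (intro prob_eq_AE) auto
  then show ?case by simp
next
  case (Suc n)
  let ?E = "{\<omega>\<in>space M. (\<forall>m\<le>n. X m \<omega> \<noteq> z) \<and> X (Suc n) \<omega> = z}"
  have [measurable]: "trajectory X n \<in> M \<rightarrow>\<^sub>M count_space UNIV"
    by (rule measurable_trajectory) simp
  have fibre: "emeasure M {\<omega>\<in>?E. trajectory X n \<omega> = l} \<le>
      ennreal e * emeasure M {\<omega>\<in>space M. trajectory X n \<omega> = l}" for l
  proof -
    have tr: "{\<omega>\<in>space M. trajectory X n \<omega> = l} = {\<omega>\<in>space M. \<forall>m\<le>n. X m \<omega> = l ! m}"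
      if "length l = Suc n"
      using that by (auto simp: trajectory_eq_iff)
    show ?thesis
    \<comment> \<open>Only a history of positive probability whose last state is not
      \<open>z\<close> contributes; every other fibre is empty or null.\<close>
    proof (cases "length l = Suc n \<and> l ! n \<noteq> z \<and> \<P>(\<omega> in M. \<forall>m\<le>n. X m \<omega> = l ! m) > 0")
      case True
      have "prob {\<omega>\<in>?E. trajectory X n \<omega> = l} \<le>
          \<P>(\<omega> in M. X (Suc n) \<omega> = z \<and> (\<forall>m\<le>n. X m \<omega> = l ! m))"
        by (intro finite_measure_mono) (auto simp: trajectory_eq_iff)
      also have "\<dots> \<le> e * \<P>(\<omega> in M. \<forall>m\<le>n. X m \<omega> = l ! m)"
        using step[of n "(!) l"] True by (simp add: cond_prob_def divide_le_eq)
      finally show ?thesis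
        using True tr \<open>e \<ge> 0\<close> by (simp add: emeasure_eq_measure ennreal_mult[symmetric])
    next
      case False
      have "emeasure M {\<omega>\<in>?E. trajectory X n \<omega> = l} = 0"
      proof (cases "length l = Suc n \<and> l ! n \<noteq> z")
        case True
        then have "prob {\<omega>\<in>space M. trajectory X n \<omega> = l} = 0"
          using False tr measure_nonneg[of M] by (simp add: less_le)
        moreover have "prob {\<omega>\<in>?E. trajectory X n \<omega> = l} \<le> prob {\<omega>\<in>space M. trajectory X n \<omega> = l}"
          by (intro finite_measure_mono) auto
        ultimately show ?thesis using measure_nonneg[of M] by (simp add: emeasure_eq_measure order_antisym)
      next
        case False
        then have "{\<omega>\<in>?E. trajectory X n \<omega> = l} = {}" by (auto simp: trajectory_eq_iff)
        then show ?thesis by (simp only: emeasure_empty)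
      qed
      then show ?thesis by simp
    qed
  qed
  have "emeasure M ?E = (\<integral>\<^sup>+ l. emeasure M {\<omega>\<in>?E. trajectory X n \<omega> = l} \<partial>count_space UNIV)"
    by (intro emeasure_eq_sum_fibres) measurable
  also have "\<dots> \<le> (\<integral>\<^sup>+ l. ennreal e * emeasure M {\<omega>\<in>space M. trajectory X n \<omega> = l} \<partial>count_space UNIV)"
    by (intro nn_integral_mono fibre)
  also have "\<dots> = ennreal e * emeasure M (space M)"
    by (subst nn_integral_cmult) (auto simp: emeasure_eq_sum_fibres[of "trajectory X n" M "space M"])
  finally have E: "prob ?E \<le> e"
    using \<open>e \<ge> 0\<close> by (simp add: emeasure_eq_measure prob_space)
  have "\<P>(\<omega> in M. \<exists>m\<le>Suc n. X m \<omega> = z) \<le> prob ({\<omega>\<in>space M. \<exists>m\<le>n. X m \<omega> = z} \<union> ?E)"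
    by (intro finite_measure_mono) (auto simp: le_Suc_eq)
  also have "\<dots> \<le> \<P>(\<omega> in M. \<exists>m\<le>n. X m \<omega> = z) + prob ?E"
    by (intro measure_Un_le) measurable
  also have "\<dots> \<le> real (Suc n) * e" using Suc E by (simp add: algebra_simps)
  finally show ?case .
qed

text \<open>On a countable type an image measure has the fibre masses as its density with respect to
  counting measure, so it suffices to compare atom by atom.\<close>

lemma nn_integral_le_of_fibres:
  fixes L :: "'a \<Rightarrow> 'c :: countable" and L' :: "'b \<Rightarrow> 'c"
  assumes [measurable]: "L \<in> M \<rightarrow>\<^sub>M count_space UNIV" "L' \<in> M' \<rightarrow>\<^sub>M count_space UNIV"
    and le: "\<And>l. l \<in> A \<Longrightarrow> emeasure M' {\<omega>\<in>space M'. L' \<omega> = l} \<le> emeasure M {\<omega>\<in>space M. L \<omega> = l}"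
  shows "(\<integral>\<^sup>+ \<omega>. u (L' \<omega>) * indicator A (L' \<omega>) \<partial>M') \<le> (\<integral>\<^sup>+ \<omega>. u (L \<omega>) \<partial>M)"
proof -
  have law: "(\<integral>\<^sup>+ \<omega>. v (K \<omega>) \<partial>N) = (\<integral>\<^sup>+ l. emeasure N {\<omega>\<in>space N. K \<omega> = l} * v l \<partial>count_space UNIV)"
    if [measurable]: "K \<in> N \<rightarrow>\<^sub>M count_space UNIV" for K :: "'d \<Rightarrow> 'c" and N v
  proof -
    have "distr N (count_space UNIV) K =
        density (count_space UNIV) (\<lambda>l. emeasure N {\<omega>\<in>space N. K \<omega> = l})"
    proof (rule measure_eqI_countable[where A=UNIV])
      fix l
      have "K -` {l} \<inter> space N = {\<omega>\<in>space N. K \<omega> = l}" by auto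
      then show "emeasure (distr N (count_space UNIV) K) {l} =
          emeasure (density (count_space UNIV) (\<lambda>l. emeasure N {\<omega>\<in>space N. K \<omega> = l})) {l}"
        by (simp add: emeasure_distr emeasure_density nn_integral_count_space_finite
            flip: nn_integral_count_space_indicator)
    qed auto
    then have "(\<integral>\<^sup>+ l. v l \<partial>distr N (count_space UNIV) K) =
        (\<integral>\<^sup>+ l. emeasure N {\<omega>\<in>space N. K \<omega> = l} * v l \<partial>count_space UNIV)"
      by (simp add: nn_integral_density)
    then show ?thesis by (simp add: nn_integral_distr)
  qed
  show ?thesis
    unfolding law[OF assms(1)] law[OF assms(2), of "\<lambda>l. u l * indicator A l"]
    by (intro nn_integral_mono) (auto simp: indicator_def intro!: mult_right_mono le)
qed

text \<open>The law of \<open>L'\<close> on \<open>A\<close> is a subprobability dominated by the law of \<open>L\<close>; apply this to the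
  nonnegative functions \<open>B + g\<close> and \<open>B - g\<close>.\<close>

lemma expectation_diff_le_of_fibres:
  fixes L :: "'a \<Rightarrow> 'c :: countable" and L' :: "'b \<Rightarrow> 'c" and g :: "'c \<Rightarrow> real"
  assumes "prob_space M" "prob_space M'"
    and L[measurable]: "L \<in> M \<rightarrow>\<^sub>M count_space UNIV" "L' \<in> M' \<rightarrow>\<^sub>M count_space UNIV"
    and le: "\<And>l. l \<in> A \<Longrightarrow> \<P>(\<omega> in M'. L' \<omega> = l) \<le> \<P>(\<omega> in M. L \<omega> = l)"
    and bad: "\<P>(\<omega> in M'. L' \<omega> \<notin> A) \<le> e" and g: "\<And>l. \<bar>g l\<bar> \<le> B"
  shows "\<bar>(\<integral>\<omega>. g (L' \<omega>) \<partial>M') - (\<integral>\<omega>. g (L \<omega>) \<partial>M)\<bar> \<le> 2 * B * e"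
proof -
  interpret M: prob_space M by fact
  interpret M': prob_space M' by fact
  have B: "B \<ge> 0" using order_trans[OF abs_ge_zero g] by blast
  have int: "integrable M (\<lambda>\<omega>. f (L \<omega>))" "integrable M' (\<lambda>\<omega>. f (L' \<omega>))"
    if "\<And>l. \<bar>f l\<bar> \<le> C" for f :: "'c \<Rightarrow> real" and C
    using that by (auto intro!: M.integrable_const_bound[where B=C] M'.integrable_const_bound[where B=C])
  \<comment> \<open>On \<open>A\<close> the domination of the laws applies; off \<open>A\<close> the
    integrand is at most \<open>C\<close> and the mass at most \<open>e\<close>.\<close>
  have key: "(\<integral>\<omega>. u (L' \<omega>) \<partial>M') \<le> (\<integral>\<omega>. u (L \<omega>) \<partial>M) + C * e"
    if u: "\<And>l. 0 \<le> u l" "\<And>l. u l \<le> C" for u C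
  proof -
    have C: "C \<ge> 0" using order_trans[OF u] by blast
    have u_ind: "\<bar>u l * indicator A l\<bar> \<le> C" for l using u C by (auto simp: indicator_def)
    have "(\<integral>\<^sup>+ \<omega>. ennreal (u (L' \<omega>)) * indicator A (L' \<omega>) \<partial>M') \<le> (\<integral>\<^sup>+ \<omega>. ennreal (u (L \<omega>)) \<partial>M)"
      using le by (intro nn_integral_le_of_fibres)
        (auto simp: M.emeasure_eq_measure M'.emeasure_eq_measure)
    moreover have "(\<integral>\<^sup>+ \<omega>. ennreal (u (L' \<omega>)) * indicator A (L' \<omega>) \<partial>M') =
        ennreal (\<integral>\<omega>. u (L' \<omega>) * indicator A (L' \<omega>) \<partial>M')"
      using int(2)[OF u_ind] u
      by (subst nn_integral_eq_integral[symmetric])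
         (auto simp: indicator_def intro!: nn_integral_cong)
    moreover have "(\<integral>\<^sup>+ \<omega>. ennreal (u (L \<omega>)) \<partial>M) = ennreal (\<integral>\<omega>. u (L \<omega>) \<partial>M)"
      using int(1)[of u C] u by (intro nn_integral_eq_integral) (auto simp: abs_le_iff)
    ultimately have 1: "(\<integral>\<omega>. u (L' \<omega>) * indicator A (L' \<omega>) \<partial>M') \<le> (\<integral>\<omega>. u (L \<omega>) \<partial>M)"
      using u by (simp add: ennreal_le_iff)
    have bad_int: "(\<integral>\<omega>. C * indicator (- A) (L' \<omega>) \<partial>M') = C * \<P>(\<omega> in M'. L' \<omega> \<notin> A)"
    proof -
      have "(\<integral>\<omega>. C * indicator (- A) (L' \<omega>) \<partial>M') =
          (\<integral>\<omega>. C * indicator {\<omega>\<in>space M'. L' \<omega> \<notin> A} \<omega> \<partial>M')"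
        by (intro Bochner_Integration.integral_cong) (auto simp: indicator_def)
      then show ?thesis by simp
    qed
    have "(\<integral>\<omega>. u (L' \<omega>) \<partial>M') \<le>
        (\<integral>\<omega>. u (L' \<omega>) * indicator A (L' \<omega>) + C * indicator (- A) (L' \<omega>) \<partial>M')"
    proof (rule integral_mono)
      show "integrable M' (\<lambda>\<omega>. u (L' \<omega>))" using int(2)[of u C] u by (auto simp: abs_le_iff)
      show "integrable M' (\<lambda>\<omega>. u (L' \<omega>) * indicator A (L' \<omega>) + C * indicator (- A) (L' \<omega>))"
        using int(2)[of "\<lambda>l. u l * indicator A l + C * indicator (- A) l" C] u C
        by (auto simp: indicator_def)
      show "u (L' \<omega>) \<le> u (L' \<omega>) * indicator A (L' \<omega>) + C * indicator (- A) (L' \<omega>)" for \<omega>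
        using u by (auto simp: indicator_def)
    qed
    also have "\<dots> = (\<integral>\<omega>. u (L' \<omega>) * indicator A (L' \<omega>) \<partial>M') + C * \<P>(\<omega> in M'. L' \<omega> \<notin> A)"
      unfolding bad_int[symmetric] using C
      by (intro Bochner_Integration.integral_add int(2)[of "\<lambda>l. u l * indicator A l" C, OF u_ind]
          int(2)[of "\<lambda>l. C * indicator (- A) l" C]) (auto simp: indicator_def)
    also have "\<dots> \<le> (\<integral>\<omega>. u (L \<omega>) \<partial>M) + C * e"
      using 1 bad C by (intro add_mono mult_left_mono)
    finally show ?thesis .
  qed
  note ig = int[of g B, OF g]
  \<comment> \<open>Both shifted functions take values between \<open>0\<close> and
    \<open>2 * B\<close>, the source of that factor; the shift cancels afterwards because both
    measures have total mass \<open>1\<close>.\<close>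
  have "- B \<le> g l" "g l \<le> B" for l using g[of l] by auto
  then have "0 \<le> B + g l" "B + g l \<le> 2 * B" "0 \<le> B - g l" "B - g l \<le> 2 * B" for l
    by (simp_all add: algebra_simps) (smt (verit))+
  then have "(\<integral>\<omega>. B + g (L' \<omega>) \<partial>M') \<le> (\<integral>\<omega>. B + g (L \<omega>) \<partial>M) + 2 * B * e"
    "(\<integral>\<omega>. B - g (L' \<omega>) \<partial>M') \<le> (\<integral>\<omega>. B - g (L \<omega>) \<partial>M) + 2 * B * e"
    by (intro key; simp)+
  then show ?thesis using ig by (simp add: M.prob_space M'.prob_space)
qed

section \<open>Weak convergence\<close>

lemma topspace_skorokhod_topology: "topspace (skorokhod_topology T) = cadlag_space T"
proof -
  interpret Metric_space "cadlag_space T" "skorokhod_dist T" by (rule Metric_space_skorokhod)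
  show ?thesis by (simp add: skorokhod_topology_def)
qed

lemma borel_measure_of_generators: "{U. openin X U} \<subseteq> Pow (topspace X)"
  by (auto dest: openin_subset)

lemma continuous_map_borel_measurable:
  assumes "continuous_map X euclideanreal f"
  shows "f \<in> borel_measurable (borel_measure_of X)"
proof (rule borel_measurableI)
  fix S :: "real set" assume "open S"
  then have "openin X {x \<in> topspace X. f x \<in> S}"
    using assms by (auto simp: continuous_map_def)
  moreover have "f -` S \<inter> space (borel_measure_of X) = {x \<in> topspace X. f x \<in> S}"
    using borel_measure_of_generators[of X] by (auto simp: borel_measure_of_def space_measure_of)
  ultimately show "f -` S \<inter> space (borel_measure_of X) \<in> sets (borel_measure_of X)"
    using borel_measure_of_generators[of X] by (auto simp: borel_measure_of_def sets_measure_of)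
qed

text \<open>Shrink the open set: the limit lies in \<open>U\<close> iff, for some radius, the
  approximations eventually stay among the points whose ball of that radius is inside
  \<open>U\<close>. Asking for measurable preimages of arbitrary sets avoids any study of the
  shrunken sets; countably valued approximations satisfy it.\<close>

lemma (in Metric_space) measurable_borel_measure_of_limit:
  assumes X: "\<And>n A. {\<omega>\<in>space N. X n \<omega> \<in> A} \<in> sets N"
    and lim: "\<And>\<omega>. \<omega> \<in> space N \<Longrightarrow> limitin mtopology (\<lambda>n. X n \<omega>) (Z \<omega>) sequentially"
  shows "Z \<in> N \<rightarrow>\<^sub>M borel_measure_of mtopology"
  unfolding borel_measure_of_def
proof (rule measurable_measure_of)
  show "{U. openin mtopology U} \<subseteq> Pow (topspace mtopology)" by (rule borel_measure_of_generators)
  show "Z \<in> space N \<rightarrow> topspace mtopology" using lim by (auto simp: limitin_metric)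
  fix U assume "U \<in> {U. openin mtopology U}"
  then have U: "openin mtopology U" by simp
  \<comment> \<open>A ball around a point outside the carrier is empty, so \<open>F k\<close>
    contains all such points; this is why \<open>X n \<omega> \<in> M\<close> is carried along
    below.\<close>
  define F where "F k = {x. mball x (1 / real (Suc k)) \<subseteq> U}" for k :: nat
  have iff: "Z \<omega> \<in> U \<longleftrightarrow> (\<exists>k m. \<forall>n\<in>{m..}. X n \<omega> \<in> F k)" if \<omega>: "\<omega> \<in> space N" for \<omega>
  proof
    assume "Z \<omega> \<in> U"
    then obtain r where r: "r > 0" "mball (Z \<omega>) r \<subseteq> U" using U by (auto simp: openin_mtopology)
    then obtain k where k: "1 / real (Suc k) < r / 2"
      using nat_approx_posE[of "r / 2"] by auto
    have "\<forall>\<^sub>F n in sequentially. X n \<omega> \<in> M \<and> d (X n \<omega>) (Z \<omega>) < r / 2"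
      using lim[OF \<omega>] half_gt_zero[OF r(1)] unfolding limitin_metric by blast
    then obtain m where m: "\<And>n. n \<ge> m \<Longrightarrow> X n \<omega> \<in> M \<and> d (X n \<omega>) (Z \<omega>) < r / 2"
      by (auto simp: eventually_sequentially)
    have "X n \<omega> \<in> F k" if n: "n \<ge> m" for n
      unfolding F_def
    proof safe
      fix y assume y: "y \<in> mball (X n \<omega>) (1 / real (Suc k))"
      have "Z \<omega> \<in> M" using lim[OF \<omega>] by (simp add: limitin_metric)
      then have "d (Z \<omega>) y \<le> d (X n \<omega>) (Z \<omega>) + d (X n \<omega>) y"
        using triangle'[of "Z \<omega>" "X n \<omega>" y] m[OF n] y by (simp add: commute)
      then have "y \<in> mball (Z \<omega>) r" using m[OF n] y k \<open>Z \<omega> \<in> M\<close> by auto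
      then show "y \<in> U" using r by blast
    qed
    then show "\<exists>k m. \<forall>n\<in>{m..}. X n \<omega> \<in> F k" by auto
  next
    assume "\<exists>k m. \<forall>n\<in>{m..}. X n \<omega> \<in> F k"
    then obtain k m where km: "\<And>n. n \<ge> m \<Longrightarrow> X n \<omega> \<in> F k" by auto
    have "\<forall>\<^sub>F n in sequentially. X n \<omega> \<in> M \<and> d (X n \<omega>) (Z \<omega>) < 1 / real (Suc k)"
      using lim[OF \<omega>] unfolding limitin_metric by (metis of_nat_0_less_iff zero_less_Suc zero_less_divide_1_iff)
    then obtain m' where "\<And>n. n \<ge> m' \<Longrightarrow> X n \<omega> \<in> M \<and> d (X n \<omega>) (Z \<omega>) < 1 / real (Suc k)"
      by (auto simp: eventually_sequentially)
    then have "Z \<omega> \<in> mball (X (max m m') \<omega>) (1 / real (Suc k))"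
      using lim[OF \<omega>] by (auto simp: limitin_metric)
    then show "Z \<omega> \<in> U" using km[of "max m m'"] by (auto simp: F_def)
  qed
  have "Z -` U \<inter> space N = (\<Union>k. \<Union>m. \<Inter>n\<in>{m..}. {\<omega>\<in>space N. X n \<omega> \<in> F k})"
  proof (rule set_eqI)
    fix \<omega>
    show "\<omega> \<in> Z -` U \<inter> space N \<longleftrightarrow>
        \<omega> \<in> (\<Union>k. \<Union>m. \<Inter>n\<in>{m..}. {\<omega>\<in>space N. X n \<omega> \<in> F k})"
    proof (cases "\<omega> \<in> space N")
      case True
      then show ?thesis using iff[OF True] by simp
    qed auto
  qed
  also have "\<dots> \<in> sets N"
    by (intro sets.countable_UN sets.countable_INT' image_subsetI X UNIV_I) auto
  finally show "Z -` U \<inter> space N \<in> sets N" .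
qed

lemma grid_path_eq_trajectory:
  assumes "T > 0"
  shows "grid_path T N (\<lambda>k. X k \<omega>) = grid_path T N ((!) (trajectory X N \<omega>))"
  by (rule grid_path_cong[OF assms]) (simp add: nth_trajectory)

text \<open>\<open>A\<close> may be arbitrary because the path factors through a trajectory in a
  countable type; the limit lemma asks for exactly this.\<close>

lemma sets_grid_path:
  assumes "T > 0" "\<And>k. X k \<in> M \<rightarrow>\<^sub>M count_space UNIV"
  shows "{\<omega>\<in>space M. grid_path T N (\<lambda>k. X k \<omega>) \<in> A} \<in> sets M"
proof -
  note [measurable] = measurable_trajectory[of X, OF assms(2)]
  show ?thesis unfolding grid_path_eq_trajectory[OF assms(1)] by measurable
qed

lemma measurable_grid_path:
  assumes "T > 0" "\<And>k. X k \<in> M \<rightarrow>\<^sub>M count_space UNIV"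
  shows "(\<lambda>\<omega>. grid_path T N (\<lambda>k. X k \<omega>)) \<in> M \<rightarrow>\<^sub>M borel_measure_of (skorokhod_topology T)"
  unfolding borel_measure_of_def
proof (rule measurable_measure_of)
  show "{U. openin (skorokhod_topology T) U} \<subseteq> Pow (topspace (skorokhod_topology T))"
    by (rule borel_measure_of_generators)
  show "(\<lambda>\<omega>. grid_path T N (\<lambda>k. X k \<omega>)) \<in> space M \<rightarrow> topspace (skorokhod_topology T)"
    using grid_path_in_cadlag_space[OF assms(1)] by (simp add: topspace_skorokhod_topology)
  show "(\<lambda>\<omega>. grid_path T N (\<lambda>k. X k \<omega>)) -` U \<inter> space M \<in> sets M" for U
    using sets_grid_path[OF assms, where N=N and A=U] by (simp add: vimage_def Int_def conj_commute)
qed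

lemma path_on_continuous_time:
  "path_on T (continuous_time T N X) \<omega> = grid_path T N (\<lambda>k. X k \<omega>)"
  by (auto simp: path_on_def continuous_time_def grid_path_def)

lemma prob_skeleton:
  assumes Y: "markov_jump_process M p Y" and init: "AE \<omega> in M. Y 0 \<omega> = 1" and h: "h > 0"
    and i: "\<And>k. k \<le> n \<Longrightarrow> i k \<ge> 1"
  shows "\<P>(\<omega> in M. \<forall>m\<le>n. Y (real m * h) \<omega> = i m) =
    of_bool (i 0 = 1) * (\<Prod>m<n. p h (i m) (i (Suc m)))"
proof -
  interpret prob_space M using Y by (simp add: markov_jump_process_def)
  \<comment> \<open>\<open>prob_path\<close> wants the transition at every index and the Markov
    property covers positive target states; beyond \<open>n\<close> any positive state
    serves.\<close>
  define i' where "i' k = (if k \<le> n then i k else 1)" for k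
  have i': "i' k \<ge> 1" for k using i by (simp add: i'_def)
  have "\<P>(\<omega> in M. \<forall>m\<le>n. Y (real m * h) \<omega> = i' m) =
      of_bool (i' 0 = 1) * (\<Prod>m<n. p h (i' m) (i' (Suc m)))"
  proof (rule prob_path[where X="\<lambda>k. Y (real k * h)"])
    fix k
    have "Y (real k * h) \<in> M \<rightarrow>\<^sub>M count_space {1..}"
      using Y h by (simp add: markov_jump_process_def)
    from measurable_compose[OF this, of "\<lambda>x. x" "count_space UNIV"]
    show "Y (real k * h) \<in> M \<rightarrow>\<^sub>M count_space UNIV" by simp
    assume pos: "\<P>(\<omega> in M. \<forall>m\<le>k. Y (real m * h) \<omega> = i' m) > 0"
    have markov: "\<And>n t i s j. 0 \<le> t 0 \<and> (\<forall>k<n. t k < t (Suc k)) \<and> t n < s \<and> 1 \<le> j \<and>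
        \<P>(\<omega> in M. \<forall>k\<le>n. Y (t k) \<omega> = i k) > 0 \<longrightarrow>
        \<P>(\<omega> in M. Y s \<omega> = j \<bar> \<forall>k\<le>n. Y (t k) \<omega> = i k) = p (s - t n) (i n) j"
      using Y unfolding markov_jump_process_def by blast
    show "\<P>(\<omega> in M. Y (real (Suc k) * h) \<omega> = i' (Suc k) \<bar> \<forall>m\<le>k. Y (real m * h) \<omega> = i' m) =
        p h (i' k) (i' (Suc k))"
      using markov[of "\<lambda>m. real m * h" k "real (Suc k) * h" "i' (Suc k)" i'] pos h i'
      by (simp add: algebra_simps)
  qed (use init in simp)
  moreover have "(\<forall>m\<le>n. Y (real m * h) \<omega> = i' m) \<longleftrightarrow> (\<forall>m\<le>n. Y (real m * h) \<omega> = i m)" for \<omega>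
    by (simp add: i'_def)
  moreover have "(\<Prod>m<n. p h (i' m) (i' (Suc m))) = (\<Prod>m<n. p h (i m) (i (Suc m)))"
    by (intro prod.cong) (auto simp: i'_def)
  ultimately show ?thesis by (simp add: i'_def)
qed

theorem theorem3:
  fixes T :: real
    and lam :: "nat \<Rightarrow> real"
    and rate :: "nat \<Rightarrow> nat \<Rightarrow> real"
    and p :: "real \<Rightarrow> nat \<Rightarrow> nat \<Rightarrow> real"
    and M :: "'a measure"
    and Y :: "real \<Rightarrow> 'a \<Rightarrow> nat"
    and M' :: "nat \<Rightarrow> 'b measure"
    and Y' :: "nat \<Rightarrow> nat \<Rightarrow> 'b \<Rightarrow> nat"
  assumes "T > 0"
    and "\<And>i j. i \<ge> 1 \<Longrightarrow> j \<ge> 1 \<Longrightarrow> i \<noteq> j \<Longrightarrow> rate i j > 0"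
    and "\<And>i. i \<ge> 1 \<Longrightarrow> (rate i has_sum lam i) ({1..} - {i})"
    and "(INF i\<in>{1..}. lam i) > 0"
    and "bdd_above (lam ` {1..})"
    and "markov_jump_process M p Y"
    and "infinitesimal_matrix p (\<lambda>i j. if i = j then - lam i else rate i j)"
    and "uniformly_ergodic p"
    and "AE \<omega> in M. Y 0 \<omega> = 1"
    and "\<And>N. N \<ge> 1 \<Longrightarrow>
           markov_chain (M' N) {0..} (with_cemetery (step_matrix lam p (T / real N))) (Y' N)"
    and "\<And>N. N \<ge> 1 \<Longrightarrow> AE \<omega> in M' N. Y' N 0 \<omega> = 1"
  shows "path_on T Y \<in> M \<rightarrow>\<^sub>M borel_measure_of (skorokhod_topology T) \<and>
         (\<forall>N\<ge>1. path_on T (continuous_time T N (Y' N))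
                   \<in> M' N \<rightarrow>\<^sub>M borel_measure_of (skorokhod_topology T)) \<and>
         weak_conv_in (skorokhod_topology T)
           (\<lambda>N. distr (M' N) (borel_measure_of (skorokhod_topology T))
                  (path_on T (continuous_time T N (Y' N))))
           (distr M (borel_measure_of (skorokhod_topology T)) (path_on T Y))"
proof -
  note T = assms(1) and Y = assms(6) and Y0 = assms(9)
  have p: "transition_function p" and "prob_space M" using Y unfolding markov_jump_process_def by blast+
  interpret prob_space M by fact
  have chain: "markov_chain (M' N) {0..} (with_cemetery (step_matrix lam p (T / real N))) (Y' N)"
    if "N \<ge> 1" for N
    using assms(10) that .
  have Y'_meas: "Y' N k \<in> M' N \<rightarrow>\<^sub>M count_space UNIV" if "N \<ge> 1" for N k
    using chain[OF that] by (simp add: markov_chain_def atLeast_0)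
  have Y_cadlag: "cadlag_on {0..T} (\<lambda>t. real (Y t \<omega>))" if "\<omega> \<in> space M" for \<omega>
  proof (rule cadlag_on_subset)
    show "cadlag_on {0..} (\<lambda>t. real (Y t \<omega>))" using Y that unfolding markov_jump_process_def by blast
  qed auto
  \<comment> \<open>For \<open>N = 0\<close> the division yields \<open>0\<close>, so
    \<open>Z 0 k = Y 0\<close>; all times are nonnegative and \<open>Z N k\<close> is measurable for
    every \<open>N\<close>.\<close>
  define Z where "Z N k = Y (real k * (T / real N))" for N k :: nat
  have Y_pos: "Y t \<in> M \<rightarrow>\<^sub>M count_space {1..}" if "t \<ge> 0" for t
    using Y that by (simp add: markov_jump_process_def)
  have Z_meas: "Z N k \<in> M \<rightarrow>\<^sub>M count_space UNIV" for N k
    unfolding Z_def using T measurable_compose[OF Y_pos, of _ "\<lambda>x. x" "count_space UNIV"] by simp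
  have Z_lim: "limitin (skorokhod_topology T) (\<lambda>N. grid_path T N (\<lambda>k. Z N k \<omega>)) (path_on T Y \<omega>) sequentially"
    if "\<omega> \<in> space M" for \<omega>
    using grid_path_limit[OF T Y_cadlag[OF that]] by (simp add: Z_def path_on_def)
  have Y_path: "path_on T Y \<in> M \<rightarrow>\<^sub>M borel_measure_of (skorokhod_topology T)"
    unfolding skorokhod_topology_def
    by (rule Metric_space.measurable_borel_measure_of_limit[OF Metric_space_skorokhod,
          where X="\<lambda>N \<omega>. grid_path T N (\<lambda>k. Z N k \<omega>)"])
       (use sets_grid_path[OF T Z_meas] Z_lim in \<open>auto simp: skorokhod_topology_def\<close>)
  have Y'_path: "path_on T (continuous_time T N (Y' N)) \<in> M' N \<rightarrow>\<^sub>M borel_measure_of (skorokhod_topology T)"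
    if "N \<ge> 1" for N
    unfolding path_on_continuous_time[abs_def] by (rule measurable_grid_path[OF T Y'_meas[OF that]])

  obtain L0 where L0: "\<And>i. i \<ge> 1 \<Longrightarrow> lam i \<le> L0"
    using assms(5) by (auto simp: bdd_above_def)
  define L where "L = max L0 0"
  have L: "\<And>i. i \<ge> 1 \<Longrightarrow> lam i \<le> L" "L \<ge> 0" using L0 by (simp_all add: L_def max.coboundedI1)
  have der: "((\<lambda>t. p t i i) has_real_derivative - lam i) (at 0 within {0..})" if "i \<ge> 1" for i
    using assms(7) that unfolding infinitesimal_matrix_def by (metis (full_types))

  \<comment> \<open>Stated for every bounded \<open>f\<close>, which amounts to control in total
    variation; \<open>L\<^sup>2 * T\<^sup>2 / N\<close> is \<open>N\<close> times the loss
    \<open>L\<^sup>2 * h\<^sup>2\<close> of one step.\<close>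
  have close: "\<bar>(\<integral>\<omega>. f (grid_path T N (\<lambda>k. Y' N k \<omega>)) \<partial>M' N) - (\<integral>\<omega>. f (grid_path T N (\<lambda>k. Z N k \<omega>)) \<partial>M)\<bar>
      \<le> 2 * B * (L\<^sup>2 * T\<^sup>2 / N)"
    if N: "N \<ge> 1" and f: "\<And>x. x \<in> cadlag_space T \<Longrightarrow> \<bar>f x\<bar> \<le> B" for N f B
  proof -
    define h where "h = T / real N"
    have h: "h > 0" using T N by (simp add: h_def)
    let ?P = "with_cemetery (step_matrix lam p h)"
    interpret M': prob_space "M' N" using chain[OF N] by (simp add: markov_chain_def)
    have init': "AE \<omega> in M' N. Y' N 0 \<omega> = 1" using assms(11) N .
    have step': "\<P>(\<omega> in M' N. Y' N (Suc k) \<omega> = j \<bar> \<forall>m\<le>k. Y' N m \<omega> = i m) = ?P (i k) j"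
      if "\<P>(\<omega> in M' N. \<forall>m\<le>k. Y' N m \<omega> = i m) > 0" for k i j
      using chain[OF N] that unfolding markov_chain_def h_def by blast
    define good where "good = {l :: nat list. 0 \<notin> set l}"
    have "\<bar>(\<integral>\<omega>. f (grid_path T N ((!) (trajectory (Y' N) N \<omega>))) \<partial>M' N) -
        (\<integral>\<omega>. f (grid_path T N ((!) (trajectory (Z N) N \<omega>))) \<partial>M)\<bar> \<le> 2 * B * (N * (L\<^sup>2 * h\<^sup>2))"
    proof (rule expectation_diff_le_of_fibres[OF \<open>prob_space M\<close> M'.prob_space_axioms _ _ _ _ , where A=good])
      show "trajectory (Z N) N \<in> M \<rightarrow>\<^sub>M count_space UNIV"
        "trajectory (Y' N) N \<in> M' N \<rightarrow>\<^sub>M count_space UNIV"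
        by (intro measurable_trajectory Z_meas Y'_meas N)+
      show "\<bar>f (grid_path T N ((!) l))\<bar> \<le> B" for l
        by (intro f grid_path_in_cadlag_space T)
      have "\<P>(\<omega> in M' N. trajectory (Y' N) N \<omega> \<notin> good) = \<P>(\<omega> in M' N. \<exists>m\<le>N. Y' N m \<omega> = 0)"
        by (intro arg_cong[where f=M'.prob]) (auto simp: good_def set_trajectory)
      also have "\<dots> \<le> N * (L\<^sup>2 * h\<^sup>2)"
      proof (rule M'.prob_absorbed_le)
        show "AE \<omega> in M' N. Y' N 0 \<omega> \<noteq> 0" using init' by eventually_elim simp
        fix k i assume "\<P>(\<omega> in M' N. \<forall>m\<le>k. Y' N m \<omega> = i m) > 0" and ik: "i k \<noteq> 0"
        then have "\<P>(\<omega> in M' N. Y' N (Suc k) \<omega> = 0 \<bar> \<forall>m\<le>k. Y' N m \<omega> = i m) = ?P (i k) 0"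
          by (intro step')
        also have "\<dots> = p h (i k) (i k) - exp (- lam (i k) * h)"
          using ik h by (intro with_cemetery_step_matrix_0[OF p]) auto
        also have "\<dots> \<le> L\<^sup>2 * h\<^sup>2"
          using transition_diag_le_exp[OF p _ _ der L, of "i k" h] ik h by simp
        finally show "\<P>(\<omega> in M' N. Y' N (Suc k) \<omega> = 0 \<bar> \<forall>m\<le>k. Y' N m \<omega> = i m) \<le> L\<^sup>2 * h\<^sup>2" .
      qed (simp_all add: Y'_meas[OF N])
      finally show "\<P>(\<omega> in M' N. trajectory (Y' N) N \<omega> \<notin> good) \<le> N * (L\<^sup>2 * h\<^sup>2)" .
      fix l assume "l \<in> good"
      show "\<P>(\<omega> in M' N. trajectory (Y' N) N \<omega> = l) \<le> \<P>(\<omega> in M. trajectory (Z N) N \<omega> = l)"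
      proof (cases "length l = Suc N")
        case False
        then show ?thesis by (simp add: trajectory_eq_iff)
      next
        case True
        then have pos: "l ! k \<ge> 1" if "k \<le> N" for k
          using \<open>l \<in> good\<close> that nth_mem[of k l] unfolding good_def by (cases "l ! k") auto
        have "\<P>(\<omega> in M' N. \<forall>m\<le>N. Y' N m \<omega> = l ! m) =
            of_bool (l ! 0 = 1) * (\<Prod>m<N. ?P (l ! m) (l ! Suc m))"
          by (rule M'.prob_path[where i="(!) l"]) (use Y'_meas[OF N] init' step' in auto)
        also have "\<dots> \<le> of_bool (l ! 0 = 1) * (\<Prod>m<N. p h (l ! m) (l ! Suc m))"
        \<comment> \<open>Off the diagonal the two matrices agree, on the diagonal this is
          \<open>exp_le_transition_diag\<close>; row and column \<open>0\<close> do not occur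
          because \<open>l\<close> is good.\<close>
        proof (intro mult_left_mono prod_mono)
          fix m assume "m \<in> {..<N}"
          then have m: "l ! m \<ge> 1" "l ! Suc m \<ge> 1" using pos by auto
          then show "0 \<le> ?P (l ! m) (l ! Suc m) \<and> ?P (l ! m) (l ! Suc m) \<le> p h (l ! m) (l ! Suc m)"
            using exp_le_transition_diag[OF p m(1) der[OF m(1)], of h]
              transition_function_bounds[OF p m, of h] h
            by (auto simp: with_cemetery_def step_matrix_def)
        qed simp
        also have "\<dots> = \<P>(\<omega> in M. \<forall>m\<le>N. Z N m \<omega> = l ! m)"
          unfolding Z_def h_def[symmetric] using prob_skeleton[OF Y Y0 h, of N "(!) l"] pos by simp
        finally show ?thesis using True by (simp add: trajectory_eq_iff)
      qed
    qed
    also have "N * (L\<^sup>2 * h\<^sup>2) = L\<^sup>2 * T\<^sup>2 / N"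
      using N by (simp add: h_def power2_eq_square)
    finally show ?thesis
      using grid_path_eq_trajectory[OF T, of N "Y' N"] grid_path_eq_trajectory[OF T, of N "Z N"] by simp
  qed

  have "weak_conv_in (skorokhod_topology T)
      (\<lambda>N. distr (M' N) (borel_measure_of (skorokhod_topology T)) (path_on T (continuous_time T N (Y' N))))
      (distr M (borel_measure_of (skorokhod_topology T)) (path_on T Y))"
    unfolding weak_conv_in_def topspace_skorokhod_topology
  proof (intro allI impI, elim conjE)
    fix f assume f: "continuous_map (skorokhod_topology T) euclideanreal f" "bounded (f ` cadlag_space T)"
    obtain B where B: "\<And>x. x \<in> cadlag_space T \<Longrightarrow> \<bar>f x\<bar> \<le> B"
      using f(2) by (auto simp: bounded_iff)
    note f_meas[measurable] = continuous_map_borel_measurable[OF f(1)]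
    note [measurable] = measurable_grid_path[OF T Z_meas] Y_path
    have "(\<lambda>N. \<integral>\<omega>. f (grid_path T N (\<lambda>k. Z N k \<omega>)) \<partial>M) \<longlonglongrightarrow> (\<integral>\<omega>. f (path_on T Y \<omega>) \<partial>M)"
    proof (rule integral_dominated_convergence[where w="\<lambda>_. B"])
      show "AE \<omega> in M. (\<lambda>N. f (grid_path T N (\<lambda>k. Z N k \<omega>))) \<longlonglongrightarrow> f (path_on T Y \<omega>)"
      proof (rule AE_I2)
        fix \<omega> assume "\<omega> \<in> space M"
        from continuous_map_limit[OF f(1) Z_lim[OF this]]
        show "(\<lambda>N. f (grid_path T N (\<lambda>k. Z N k \<omega>))) \<longlonglongrightarrow> f (path_on T Y \<omega>)"
          by (simp add: comp_def)
      qed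
      show "AE \<omega> in M. norm (f (grid_path T N (\<lambda>k. Z N k \<omega>))) \<le> B" for N
        using B grid_path_in_cadlag_space[OF T] by simp
    qed measurable
    moreover have "(\<lambda>N. (\<integral>\<omega>. f (grid_path T N (\<lambda>k. Y' N k \<omega>)) \<partial>M' N) -
        (\<integral>\<omega>. f (grid_path T N (\<lambda>k. Z N k \<omega>)) \<partial>M)) \<longlonglongrightarrow> 0"
    proof (rule Lim_null_comparison)
      show "\<forall>\<^sub>F N in sequentially. norm ((\<integral>\<omega>. f (grid_path T N (\<lambda>k. Y' N k \<omega>)) \<partial>M' N) -
        (\<integral>\<omega>. f (grid_path T N (\<lambda>k. Z N k \<omega>)) \<partial>M)) \<le> 2 * B * (L\<^sup>2 * T\<^sup>2 / N)"
        using eventually_ge_at_top[of 1] by eventually_elim (use close[OF _ B] in simp)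
      show "(\<lambda>N. 2 * B * (L\<^sup>2 * T\<^sup>2 / real N)) \<longlonglongrightarrow> 0"
        by (intro tendsto_mult_right_zero tendsto_divide_0[OF tendsto_const]
            filterlim_at_top_imp_at_infinity filterlim_real_sequentially)
    qed
    ultimately have "(\<lambda>N. \<integral>\<omega>. f (grid_path T N (\<lambda>k. Y' N k \<omega>)) \<partial>M' N) \<longlonglongrightarrow> (\<integral>\<omega>. f (path_on T Y \<omega>) \<partial>M)"
      using tendsto_add by fastforce
    \<comment> \<open>The hypotheses on \<open>M' N\<close> begin at \<open>N = 1\<close>, so the
      change of variables is claimed only eventually.\<close>
    moreover have "\<forall>\<^sub>F N in sequentially. (\<integral>\<omega>. f (grid_path T N (\<lambda>k. Y' N k \<omega>)) \<partial>M' N) =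
        (\<integral>x. f x \<partial>distr (M' N) (borel_measure_of (skorokhod_topology T)) (path_on T (continuous_time T N (Y' N))))"
      using eventually_ge_at_top[of 1]
      by eventually_elim (simp add: integral_distr[OF Y'_path f_meas] path_on_continuous_time)
    ultimately show "(\<lambda>N. \<integral>x. f x \<partial>distr (M' N) (borel_measure_of (skorokhod_topology T))
          (path_on T (continuous_time T N (Y' N))))
        \<longlonglongrightarrow> (\<integral>x. f x \<partial>distr M (borel_measure_of (skorokhod_topology T)) (path_on T Y))"
      unfolding integral_distr[OF Y_path f_meas] by (rule Lim_transform_eventually)
  qed
  then show ?thesis using Y_path Y'_path by blast
qed

end
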